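(* Let $n\in\mathbb{N}$, $n\geq 1$, and let $X=\mathbb{H}/\Gamma_{S_n}$ be the quotient surface of a Fuchsian Schottky group $\Gamma_{S_n}$ of rank $n$. From the point of view of the Euler characteristic (that is, considering all types $(g,n_{F'})$ of genus and number of funnel ends permitted by the Euler characteristic of $X$, as described in the context): (i) the quotient surface is of $\frac{n+2}{2}$ types of hyperbolic surfaces when $n$ is even, and of $\frac{n+1}{2}$ types of hyperbolic surfaces when $n$ is odd; (ii) the quotient surface contains the maximum number of funnel ends, namely $n+1$, when it has no genus ($g=0$); (iii) the quotient surface contains the minimum number of funnel ends, namely $1$ if $n$ is even and $2$ if $n$ is odd, when it has genus $\frac n2$ (for $n$ even), respectively $\frac{n-1}{2}$ (for $n$ odd).
   Context: $\mathbb{H}$ is the upper half-plane model of the hyperbolic plane. Fuchsian Schottky group of rank $n$: let $D_1,\dots,D_{2n}$ be open, mutually disjoint and mutually non-tangential Euclidean half-discs in $\mathbb{H}$ with centers on the real line, such that for each $j=1,\dots,n$ the half-discs $D_j$ and $D_{j+n}$ are reflections of each other in the imaginary axis. For each $j=1,\dots,n$ let $S'_j\in PSL(2,\mathbb{R})$ be a hyperbolic transformation sending $\partial D_j$ to $\partial D_{j+n}$ and mapping the exterior of $D_j$ onto the interior of $D_{j+n}$. Then $\Gamma_{S_n}=\langle S'_1,\dots,S'_n\rangle$ is called the Fuchsian Schottky group of rank $n$. A funnel is an end of a hyperbolic surface isometric to $\{z\in\mathbb{H}:\Re z\le 0\}/\langle z\mapsto e^{l}z\rangle$ for some $l>0$.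 The group $\Gamma_{S_n}$ has no parabolic or elliptic elements, so $X=\mathbb{H}/\Gamma_{S_n}$ has no cusps; it is the union of its compact core and a finite nonempty collection of funnels. If $g$ denotes the genus and $n_{F'}$ the number of funnel ends, then $\chi(X)=2-2g-n_{F'}$; on the other hand gluing the $2n$ sides of the fundamental domain $\mathbb{H}\setminus(D_1\cup\dots\cup D_{2n})$ gives $\chi(X)=1-n$. Thus $n_{F'}+2g=n+1$ with $g\ge0$ and $n_{F'}\ge1$. "Types of hyperbolic surfaces" means the pairs $(g,n_{F'})$ of integers $g\ge 0$, $n_{F'}\ge 1$ satisfying this relation, and maximum/minimum numbers of funnel ends are taken over these types. *)

theory Defs
  imports
    "HOL-Analysis.Analysis"
    "HOL-Homology.Homology"
    "HOL-Algebra.Bij"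
    "HOL-Algebra.Group_Action"
begin

section \<open>The upper half-plane and \<open>PSL(2,\<real>)\<close>\<close>

definition upper_half_plane :: "complex set" where
  "upper_half_plane = {z. Im z > 0}"

text \<open>
  \<open>PSL(2,\<real>)\<close> is represented by its faithful action on the upper half-plane: an element is
  the bijection induced by a matrix of \<open>SL(2,\<real>)\<close>, so that \<open>A\<close> and \<open>-A\<close> give the
  same element. The maps are extensional (undefined outside the half-plane), hence equal as
  functions iff equal as transformations, and they live in the group of bijections \<open>BijGroup\<close>.
\<close>

definition moebius :: "real^2^2 \<Rightarrow> complex \<Rightarrow> complex" where
  "moebius A = (\<lambda>z\<in>upper_half_plane.
     (of_real (A $ 1 $ 1) * z + of_real (A $ 1 $ 2)) /
     (of_real (A $ 2 $ 1) * z + of_real (A $ 2 $ 2)))"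

definition PSL2R :: "(complex \<Rightarrow> complex) set" where
  "PSL2R = {moebius A | A. det A = 1}"

text \<open>The absolute value of the trace is the same for the two representatives \<open>A\<close>, \<open>-A\<close>.\<close>

definition hyperbolic :: "(complex \<Rightarrow> complex) \<Rightarrow> bool" where
  "hyperbolic S \<longleftrightarrow> (\<exists>A. det A = 1 \<and> \<bar>trace A\<bar> > 2 \<and> S = moebius A)"

section \<open>Fuchsian Schottky groups\<close>

text \<open>
  Open half-disc with real centre \<open>c\<close> and radius \<open>r\<close>; its boundary and exterior are taken
  in the upper half-plane.
\<close>

definition half_disc :: "real \<Rightarrow> real \<Rightarrow> complex set" where
  "half_disc c r = ball (of_real c) r \<inter> upper_half_plane"

definition half_disc_boundary :: "real \<Rightarrow> real \<Rightarrow> complex set" where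
  "half_disc_boundary c r = sphere (of_real c) r \<inter> upper_half_plane"

definition half_disc_exterior :: "real \<Rightarrow> real \<Rightarrow> complex set" where
  "half_disc_exterior c r = upper_half_plane - cball (of_real c) r"

text \<open>
  Two disjoint half-discs are tangent iff the distance of their centres is the sum of their
  radii. The map \<open>\<lambda>z. - cnj z\<close> is the reflection in the imaginary axis.
\<close>

definition schottky_data ::
  "nat \<Rightarrow> (nat \<Rightarrow> real) \<Rightarrow> (nat \<Rightarrow> real) \<Rightarrow> (nat \<Rightarrow> complex \<Rightarrow> complex) \<Rightarrow> bool" where
  "schottky_data n c r S \<longleftrightarrow>
     (\<forall>j\<in>{1..2*n}. r j > 0) \<and>
     (\<forall>i\<in>{1..2*n}. \<forall>j\<in>{1..2*n}. i \<noteq> j \<longrightarrow>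
        half_disc (c i) (r i) \<inter> half_disc (c j) (r j) = {} \<and> \<bar>c i - c j\<bar> \<noteq> r i + r j) \<and>
     (\<forall>j\<in>{1..n}.
        half_disc (c (j + n)) (r (j + n)) = (\<lambda>z. - cnj z) ` half_disc (c j) (r j) \<and>
        S j \<in> PSL2R \<and> hyperbolic (S j) \<and>
        S j ` half_disc_boundary (c j) (r j) = half_disc_boundary (c (j + n)) (r (j + n)) \<and>
        S j ` half_disc_exterior (c j) (r j) = half_disc (c (j + n)) (r (j + n)))"

definition fuchsian_schottky_group :: "nat \<Rightarrow> (complex \<Rightarrow> complex) set \<Rightarrow> bool" where
  "fuchsian_schottky_group n \<Gamma> \<longleftrightarrow>
     (\<exists>c r S. schottky_data n c r S \<and> \<Gamma> = generate (BijGroup upper_half_plane) (S ` {1..n}))"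

section \<open>The quotient surface\<close>

definition group_orbit :: "(complex \<Rightarrow> complex) set \<Rightarrow> complex \<Rightarrow> complex set" where
  "group_orbit \<Gamma> z = orbit (BijGroup upper_half_plane\<lparr>carrier := \<Gamma>\<rparr>) id z"

definition quotient_surface :: "(complex \<Rightarrow> complex) set \<Rightarrow> complex set topology" where
  "quotient_surface \<Gamma> = topology (\<lambda>U.
     U \<subseteq> group_orbit \<Gamma> ` upper_half_plane \<and>
     openin (top_of_set upper_half_plane) {z \<in> upper_half_plane. group_orbit \<Gamma> z \<in> U})"

lemma openin_quotient_surface:
  "openin (quotient_surface \<Gamma>) U \<longleftrightarrow>
     U \<subseteq> group_orbit \<Gamma> ` upper_half_plane \<and>
     openin (top_of_set upper_half_plane) {z \<in> upper_half_plane. group_orbit \<Gamma> z \<in> U}"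
proof -
  let ?P = "\<lambda>U. U \<subseteq> group_orbit \<Gamma> ` upper_half_plane \<and>
     openin (top_of_set upper_half_plane) {z \<in> upper_half_plane. group_orbit \<Gamma> z \<in> U}"
  have "istopology ?P"
    unfolding istopology_def
  proof (intro conjI allI impI)
    fix U V assume "?P U" "?P V"
    moreover have "{z \<in> upper_half_plane. group_orbit \<Gamma> z \<in> U \<inter> V} =
        {z \<in> upper_half_plane. group_orbit \<Gamma> z \<in> U} \<inter> {z \<in> upper_half_plane. group_orbit \<Gamma> z \<in> V}"
      by blast
    ultimately show "U \<inter> V \<subseteq> group_orbit \<Gamma> ` upper_half_plane"
      "openin (top_of_set upper_half_plane) {z \<in> upper_half_plane. group_orbit \<Gamma> z \<in> U \<inter> V}"
      by (auto intro: openin_Int)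
  next
    fix K assume K: "\<forall>U\<in>K. ?P U"
    then show "\<Union>K \<subseteq> group_orbit \<Gamma> ` upper_half_plane" by blast
    have "{z \<in> upper_half_plane. group_orbit \<Gamma> z \<in> \<Union>K} =
        (\<Union>U\<in>K. {z \<in> upper_half_plane. group_orbit \<Gamma> z \<in> U})"
      by blast
    also have "openin (top_of_set upper_half_plane) \<dots>"
      using K by (intro openin_Union) blast
    finally show "openin (top_of_set upper_half_plane) {z \<in> upper_half_plane. group_orbit \<Gamma> z \<in> \<Union>K}" .
  qed
  then show ?thesis
    by (simp add: quotient_surface_def topology_inverse')
qed

lemma quotient_map_quotient_surface:
  "quotient_map (top_of_set upper_half_plane) (quotient_surface \<Gamma>) (group_orbit \<Gamma>)"
proof -
  have "openin (quotient_surface \<Gamma>) (group_orbit \<Gamma> ` upper_half_plane)"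
  proof -
    have "{z \<in> upper_half_plane. group_orbit \<Gamma> z \<in> group_orbit \<Gamma> ` upper_half_plane}
        = upper_half_plane" by blast
    then show ?thesis by (simp add: openin_quotient_surface)
  qed
  then have "topspace (quotient_surface \<Gamma>) = group_orbit \<Gamma> ` upper_half_plane"
    by (metis openin_quotient_surface openin_subset openin_topspace subset_antisym)
  then show ?thesis
    by (auto simp: quotient_map_def openin_quotient_surface)
qed

section \<open>Euler characteristic and types\<close>

definition int_independent :: "('a, 'b) monoid_scheme \<Rightarrow> 'a set \<Rightarrow> bool" where
  "int_independent G B \<longleftrightarrow>
     (\<forall>k :: 'a \<Rightarrow> int. finprod G (\<lambda>b. b [^]\<^bsub>G\<^esub> k b) B = \<one>\<^bsub>G\<^esub> \<longrightarrow> (\<forall>b\<in>B. k b = 0))"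

text \<open>
  Rank of a multiplicatively written abelian group, meaningful when the sizes of finite
  independent sets are bounded.
\<close>

definition abelian_rank :: "('a, 'b) monoid_scheme \<Rightarrow> nat" where
  "abelian_rank G = Sup {card B | B. finite B \<and> B \<subseteq> carrier G \<and> int_independent G B}"

text \<open>
  Alternating sum of the Betti numbers of integral singular homology, meaningful for spaces
  whose homology has finite total rank.
\<close>

definition euler_characteristic :: "'a topology \<Rightarrow> int" where
  "euler_characteristic X =
     (\<Sum>p :: nat | abelian_rank (homology_group (int p) X) \<noteq> 0.
        (- 1) ^ p * int (abelian_rank (homology_group (int p) X)))"

text \<open>
  The pairs \<open>(g, f)\<close> of a genus and a positive number of funnel ends permitted by the Euler
  characteristic of a surface without cusps.
\<close>

definition surface_types :: "'a topology \<Rightarrow> (nat \<times> nat) set" where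
  "surface_types X = {(g, f). f \<ge> 1 \<and> euler_characteristic X = 2 - 2 * int g - int f}"

end

theory Submission
  imports Defs
begin

text \<open>
  Once the Euler characteristic of \<open>X = \<H>/\<Gamma>\<close> is known to be \<open>1 - n\<close>,
  the types are the pairs \<open>(g, n + 1 - 2 * g)\<close> with \<open>2 * g \<le> n\<close>, and
  all claims can be read off from this list. The substance is the computation of the Euler
  characteristic, which is defined here by singular homology.

  Remove the closed half-discs from the half-plane. The open polygon that is left maps injectively
  to an open set \<open>U\<close> of \<open>X\<close>, and the rest of \<open>X\<close> consists of
  \<open>n\<close> disjoint arcs, each obtained by gluing the boundary of \<open>D\<^sub>j\<close> to that of
  \<open>D\<^sub>j\<^sub>+\<^sub>n\<close>. Thin strips around these arcs form an open set
  \<open>V\<close> with \<open>n\<close> components. An arc cuts its strip into two halves, so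
  \<open>U \<inter> V\<close> has \<open>2 * n\<close> components. The polygon, the strips and the
  half-strips are intersections of hyperbolic half-planes, hence convex in the Klein model and
  contractible (\<open>contractible_linear_region\<close>). Excision and the exact sequence of the pair
  \<open>(X, V)\<close> then give \<open>\<chi>(X) = 1 + n - 2 * n\<close>
  (\<open>euler_characteristic_of_cover\<close>). Since the Betti numbers are ranks of abelian groups,
  reading them off the exact sequence needs additivity of the rank (\<open>has_rank_extension\<close>).

  Two properties of the group make this picture of \<open>X\<close> correct. By
  \<open>ping_pong\<close>, two points of the closed polygon lie in the same orbit only if they are equal
  or correspond to each other under a side pairing: a reduced product of generators pushes the polygon
  into one of the half-discs. By \<open>translates_cover\<close>, every orbit meets the polygon: as the
  half-discs are not tangent, all points within a fixed hyperbolic distance of the polygon are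
  equivalent to points of it, so the union of the translates is open and closed in the half-plane.
\<close>

section \<open>Rank of abelian groups\<close>

text \<open>
  A homogeneous integral linear system with more unknowns than equations has a nonzero integral
  solution: one step of Gaussian elimination without division removes an equation and an unknown.
\<close>
lemma integer_relation_exists:
  fixes c :: "'i \<Rightarrow> 'j \<Rightarrow> int"
  assumes "finite J" "finite I" "card J < card I"
  shows "\<exists>k. (\<exists>i\<in>I. k i \<noteq> 0) \<and> (\<forall>j\<in>J. (\<Sum>i\<in>I. k i * c i j) = 0)"
  using assms
proof (induction J arbitrary: I c rule: finite_induct)
  case empty
  then have "I \<noteq> {}" by auto
  then show ?case by (intro exI[of _ "\<lambda>_. 1"]) auto
next
  case (insert a J)
  show ?case
  proof (cases "\<forall>i\<in>I. c i a = 0")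
    case True
    have "card J < card I" using insert by simp
    then obtain k where "\<exists>i\<in>I. k i \<noteq> 0" "\<forall>j\<in>J. (\<Sum>i\<in>I. k i * c i j) = 0"
      using insert by blast
    with True show ?thesis by (intro exI[of _ k]) auto
  next
    case False
    then obtain i0 where i0: "i0 \<in> I" "c i0 a \<noteq> 0" by blast
    define I' where "I' = I - {i0}"
    have I': "finite I'" "I = insert i0 I'" "i0 \<notin> I'" "card J < card I'"
      using insert i0 unfolding I'_def by auto
    obtain k where k: "\<exists>i\<in>I'. k i \<noteq> 0"
      "\<forall>j\<in>J. (\<Sum>i\<in>I'. k i * (c i0 a * c i j - c i a * c i0 j)) = 0"
      using insert.IH[OF I'(1,4), of "\<lambda>i j. c i0 a * c i j - c i a * c i0 j"] by blast
    \<comment> \<open>The scaling by the pivot \<open>c i0 a\<close> keeps the solution integral.\<close>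
    define k' where "k' i = (if i = i0 then - (\<Sum>i\<in>I'. k i * c i a) else c i0 a * k i)" for i
    have sum: "(\<Sum>i\<in>I. k' i * c i j) = (\<Sum>i\<in>I'. k i * (c i0 a * c i j - c i a * c i0 j))" for j
    proof -
      have "(\<Sum>i\<in>I'. k' i * c i j) = (\<Sum>i\<in>I'. c i0 a * k i * c i j)"
        using I'(3) by (intro sum.cong) (auto simp: k'_def)
      moreover have "k' i0 * c i0 j = - (\<Sum>i\<in>I'. k i * c i a * c i0 j)"
        by (simp add: k'_def sum_distrib_right)
      moreover have "(\<Sum>i\<in>I. k' i * c i j) = k' i0 * c i0 j + (\<Sum>i\<in>I'. k' i * c i j)"
        using I'(1,3) unfolding I'(2) by simp
      ultimately show ?thesis
        by (simp add: right_diff_distrib sum_subtractf mult_ac)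
    qed
    have "(\<Sum>i\<in>I. k' i * c i j) = 0" if "j \<in> insert a J" for j
      using that k(2) unfolding sum by (auto simp: mult_ac)
    moreover have "\<exists>i\<in>I. k' i \<noteq> 0"
      using k(1) i0 I'(2,3) by (auto simp: k'_def)
    ultimately show ?thesis by blast
  qed
qed

definition lincomb :: "('a, 'b) monoid_scheme \<Rightarrow> 'a set \<Rightarrow> ('a \<Rightarrow> int) \<Rightarrow> 'a" where
  "lincomb G A k = finprod G (\<lambda>a. a [^]\<^bsub>G\<^esub> k a) A"

lemma int_independent_iff_lincomb:
  "int_independent G B \<longleftrightarrow> (\<forall>k. lincomb G B k = \<one>\<^bsub>G\<^esub> \<longrightarrow> (\<forall>b\<in>B. k b = 0))"
  by (simp add: int_independent_def lincomb_def)

context comm_group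
begin

lemma lincomb_closed [simp]: "A \<subseteq> carrier G \<Longrightarrow> lincomb G A k \<in> carrier G"
  unfolding lincomb_def by (rule finprod_closed) auto

lemma lincomb_empty [simp]: "lincomb G {} k = \<one>"
  by (simp add: lincomb_def)

lemma lincomb_insert [simp]:
  assumes "finite A" "a \<notin> A" "insert a A \<subseteq> carrier G"
  shows "lincomb G (insert a A) k = a [^] k a \<otimes> lincomb G A k"
  unfolding lincomb_def using assms by (subst finprod_insert) auto

lemma lincomb_cong:
  assumes "A \<subseteq> carrier G" "\<And>a. a \<in> A \<Longrightarrow> k a = l a"
  shows "lincomb G A k = lincomb G A l"
  unfolding lincomb_def using assms by (intro finprod_cong') auto

lemma lincomb_zero: "A \<subseteq> carrier G \<Longrightarrow> lincomb G A (\<lambda>_. 0) = \<one>"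
  unfolding lincomb_def by (simp add: int_pow_0)

lemma lincomb_add:
  assumes "A \<subseteq> carrier G"
  shows "lincomb G A (\<lambda>a. k a + l a) = lincomb G A k \<otimes> lincomb G A l"
proof -
  have "lincomb G A (\<lambda>a. k a + l a) = finprod G (\<lambda>a. a [^] k a \<otimes> a [^] l a) A"
    unfolding lincomb_def using assms by (intro finprod_cong') (auto simp: int_pow_mult)
  also have "\<dots> = lincomb G A k \<otimes> lincomb G A l"
    unfolding lincomb_def using assms by (intro finprod_multf) auto
  finally show ?thesis .
qed

lemma lincomb_int_pow:
  assumes "finite A" "A \<subseteq> carrier G"
  shows "lincomb G A k [^] (m::int) = lincomb G A (\<lambda>a. k a * m)"
  using assms by (induction A rule: finite_induct) (auto simp: int_pow_distrib int_pow_pow)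

lemma lincomb_Un:
  assumes "finite A" "finite B" "A \<inter> B = {}" "A \<subseteq> carrier G" "B \<subseteq> carrier G"
  shows "lincomb G (A \<union> B) k = lincomb G A k \<otimes> lincomb G B k"
  unfolding lincomb_def using assms by (intro finprod_Un_disjoint) auto

lemma lincomb_lincomb:
  assumes "finite B" "A \<subseteq> carrier G"
  shows "finprod G (\<lambda>b. lincomb G A (c b)) B = lincomb G A (\<lambda>a. \<Sum>b\<in>B. c b a)"
  using assms
  by (induction B rule: finite_induct) (auto simp: lincomb_zero lincomb_add)

text \<open>
  The Steinitz bound over the integers. A maximal independent set need not generate: the number 2
  alone is one in the integers. So only nonzero multiples are required to lie in the span of
  \<open>A\<close>; a relation between the coefficient vectors, rescaled by the
  multiples, is then a relation between the elements of \<open>B\<close>.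
\<close>
lemma card_independent_le:
  assumes A: "finite A" "A \<subseteq> carrier G" and B: "finite B" "B \<subseteq> carrier G"
    and span: "\<And>b. b \<in> B \<Longrightarrow> \<exists>d k. d \<noteq> 0 \<and> b [^] (d::int) = lincomb G A k"
    and ind: "int_independent G B"
  shows "card B \<le> card A"
proof (rule ccontr)
  assume "\<not> card B \<le> card A"
  then have less: "card A < card B" by simp
  obtain d c where dc: "\<And>b. b \<in> B \<Longrightarrow> d b \<noteq> 0 \<and> b [^] (d b::int) = lincomb G A (c b)"
    using span by metis
  obtain k where k: "\<exists>b\<in>B. k b \<noteq> 0" "\<forall>a\<in>A. (\<Sum>b\<in>B. k b * c b a) = 0"
    using integer_relation_exists[OF A(1) B(1) less] by blast
  have "lincomb G B (\<lambda>b. d b * k b) = finprod G (\<lambda>b. lincomb G A (\<lambda>a. c b a * k b)) B"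
    unfolding lincomb_def[of G B]
  proof (rule finprod_cong')
    fix b assume b: "b \<in> B"
    then have "b [^] (d b * k b) = (b [^] d b) [^] k b"
      using B(2) by (simp add: int_pow_pow subset_iff)
    also have "\<dots> = lincomb G A (\<lambda>a. c b a * k b)"
      using dc[OF b] A by (simp add: lincomb_int_pow)
    finally show "b [^] (d b * k b) = lincomb G A (\<lambda>a. c b a * k b)" .
  qed (use A in auto)
  also have "\<dots> = lincomb G A (\<lambda>a. \<Sum>b\<in>B. c b a * k b)"
    using A B by (simp add: lincomb_lincomb)
  also have "\<dots> = lincomb G A (\<lambda>_. 0)"
    using A k(2) by (intro lincomb_cong) (auto simp: mult.commute)
  finally have "lincomb G B (\<lambda>b. d b * k b) = \<one>"
    using A by (simp add: lincomb_zero)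
  then have "\<forall>b\<in>B. d b * k b = 0"
    using ind unfolding int_independent_iff_lincomb by blast
  with dc k(1) show False by fastforce
qed

lemma independent_not_one:
  assumes "finite B" "B \<subseteq> carrier G" "int_independent G B" "b \<in> B"
  shows "b \<noteq> \<one>"
proof
  assume "b = \<one>"
  have "lincomb G B (\<lambda>x. if x = b then 1 else 0) = \<one>"
    unfolding lincomb_def using \<open>b = \<one>\<close> assms(2)
    by (intro finprod_one_eqI) auto
  then show False
    using assms unfolding int_independent_iff_lincomb by fastforce
qed

end

lemma lincomb_hom:
  assumes "comm_group G" "comm_group H" "h \<in> hom G H" "finite A" "A \<subseteq> carrier G" "inj_on h A"
  shows "lincomb H (h ` A) k = h (lincomb G A (\<lambda>a. k (h a)))"
proof -
  interpret G: comm_group G by fact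
  interpret H: comm_group H by fact
  interpret hom: group_hom G H h
    using assms by unfold_locales auto
  show ?thesis using assms(4-6)
  proof (induction A rule: finite_induct)
    case (insert a A)
    then have "h a \<notin> h ` A" by auto
    moreover have "h ` A \<subseteq> carrier H" using insert.prems by auto
    ultimately show ?case
      using insert by (simp add: hom.hom_int_pow)
  qed simp
qed

text \<open>
  The supremum that defines the rank is attained at \<open>r\<close>. As a relation this also asserts
  that independent sets are bounded, which a value of the supremum alone would not.
\<close>
definition has_rank :: "('a, 'b) monoid_scheme \<Rightarrow> nat \<Rightarrow> bool" where
  "has_rank G r \<longleftrightarrow>
     (\<exists>A. finite A \<and> A \<subseteq> carrier G \<and> int_independent G A \<and> card A = r) \<and>
     (\<forall>B. finite B \<and> B \<subseteq> carrier G \<and> int_independent G B \<longrightarrow> card B \<le> r)"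

lemma has_rank_upper:
  "has_rank G r \<Longrightarrow> finite B \<Longrightarrow> B \<subseteq> carrier G \<Longrightarrow> int_independent G B \<Longrightarrow> card B \<le> r"
  unfolding has_rank_def by blast

lemma abelian_rank_eq: "has_rank G r \<Longrightarrow> abelian_rank G = r"
  unfolding abelian_rank_def has_rank_def
  by (intro cSup_eq_maximum) auto

lemma has_rank_unique: "has_rank G r \<Longrightarrow> has_rank G s \<Longrightarrow> r = s"
  using abelian_rank_eq by blast

lemma independent_image:
  assumes "comm_group G" "comm_group H" "h \<in> hom G H" "finite A" "A \<subseteq> carrier G"
    "inj_on h (carrier G)" "int_independent G A"
  shows "int_independent H (h ` A)"
  unfolding int_independent_iff_lincomb
proof (intro allI impI)
  interpret G: comm_group G by fact
  interpret H: comm_group H by fact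
  fix k assume "lincomb H (h ` A) k = \<one>\<^bsub>H\<^esub>"
  then have "h (lincomb G A (\<lambda>a. k (h a))) = h \<one>\<^bsub>G\<^esub>"
    using assms inj_on_subset[OF assms(6,5)] by (simp add: lincomb_hom hom_one[OF assms(3)])
  then have "lincomb G A (\<lambda>a. k (h a)) = \<one>\<^bsub>G\<^esub>"
    using assms(5,6) by (auto dest: inj_onD)
  with assms(7) show "\<forall>b\<in>h ` A. k b = 0"
    unfolding int_independent_iff_lincomb by blast
qed

lemma has_rank_if_bounded:
  assumes "\<And>B. finite B \<Longrightarrow> B \<subseteq> carrier G \<Longrightarrow> int_independent G B \<Longrightarrow> card B \<le> m"
  obtains r where "has_rank G r"
proof -
  let ?P = "\<lambda>r. \<exists>A. finite A \<and> A \<subseteq> carrier G \<and> int_independent G A \<and> card A = r"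
  have "?P 0" by (intro exI[of _ "{}"]) (simp add: int_independent_def)
  moreover have "\<forall>r. ?P r \<longrightarrow> r \<le> m" using assms by blast
  ultimately have "?P (Greatest ?P)" "\<forall>r. ?P r \<longrightarrow> r \<le> Greatest ?P"
    using GreatestI_nat[of ?P 0 m] Greatest_le_nat[of ?P _ m] by blast+
  then have "has_rank G (Greatest ?P)" unfolding has_rank_def by blast
  then show thesis by (rule that)
qed

lemma iso_independent_transfer:
  assumes "comm_group G" "comm_group H" "G \<cong> H"
    "finite B" "B \<subseteq> carrier G" "int_independent G B"
  shows "\<exists>B'. finite B' \<and> B' \<subseteq> carrier H \<and> int_independent H B' \<and> card B' = card B"
proof -
  obtain h where "h \<in> iso G H" using assms(3) by (auto simp: is_iso_def)
  then have h: "h \<in> hom G H" "inj_on h (carrier G)" by (auto simp: iso_def bij_betw_def)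
  have "card (h ` B) = card B"
    using inj_on_subset[OF h(2) assms(5)] by (rule card_image)
  moreover have "h ` B \<subseteq> carrier H"
    using h(1) assms(5) by (auto simp: hom_def)
  ultimately show ?thesis
    using independent_image[OF assms(1,2) h(1) assms(4,5) h(2) assms(6)] assms(4) by blast
qed

lemma has_rank_iso:
  assumes "comm_group G" "comm_group H" "G \<cong> H" "has_rank G r"
  shows "has_rank H r"
proof -
  interpret G: comm_group G by fact
  have "H \<cong> G" using assms(3) by (rule G.iso_sym)
  have "\<exists>A. finite A \<and> A \<subseteq> carrier H \<and> int_independent H A \<and> card A = r"
    using assms(4) iso_independent_transfer[OF assms(1-3)] unfolding has_rank_def by blast
  moreover have "card B \<le> r" if "finite B" "B \<subseteq> carrier H" "int_independent H B" for B
    using assms(4) iso_independent_transfer[OF assms(2,1) \<open>H \<cong> G\<close> that]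
    unfolding has_rank_def by (elim exE conjE) metis
  ultimately show ?thesis unfolding has_rank_def by blast
qed

lemma has_rank_trivial:
  assumes "comm_group G" "trivial_group G"
  shows "has_rank G 0"
proof -
  interpret comm_group G by fact
  have "card B = 0" if B: "finite B" "B \<subseteq> carrier G" "int_independent G B" for B
  proof -
    have "b \<noteq> \<one>\<^bsub>G\<^esub>" "b = \<one>\<^bsub>G\<^esub>" if "b \<in> B" for b
      using independent_not_one[OF B that] that B(2) assms(2) by (auto simp: trivial_group_def)
    then show ?thesis by (metis card_0_eq B(1) equals0I)
  qed
  moreover have "int_independent G {}" by (simp add: int_independent_def)
  ultimately show ?thesis
    unfolding has_rank_def by (intro conjI exI[of _ "{}"]) auto
qed

text \<open>
  Adding \<open>g\<close> to \<open>A\<close> creates a relation, and independence of \<open>A\<close>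
  forces the coefficient of \<open>g\<close> in it to be nonzero.
\<close>
lemma maximal_independent_spans:
  assumes "comm_group G" "has_rank G (card A)" "finite A" "A \<subseteq> carrier G" "int_independent G A"
    and g: "g \<in> carrier G"
  shows "\<exists>d k. d \<noteq> 0 \<and> g [^]\<^bsub>G\<^esub> (d::int) = lincomb G A k"
proof (cases "g \<in> A")
  interpret comm_group G by fact
  case True
  have "lincomb G A (\<lambda>a. if a = g then 1 else 0) = g"
  proof -
    have "lincomb G (A - {g}) (\<lambda>a. if a = g then 1 else 0) = \<one>\<^bsub>G\<^esub>"
      unfolding lincomb_def by (intro finprod_one_eqI) auto
    moreover have "A = insert g (A - {g})" using True by blast
    ultimately show ?thesis
      using assms lincomb_insert[of "A - {g}" g "\<lambda>a. if a = g then 1 else 0"]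
      by (auto simp: int_pow_1)
  qed
  then show ?thesis using g by (metis int_pow_1 one_neq_zero)
next
  interpret comm_group G by fact
  case False
  have "\<not> int_independent G (insert g A)"
    using assms False unfolding has_rank_def
    by (metis card_insert_disjoint finite_insert insert_subset not_less_eq_eq order_refl)
  then obtain k where k: "g [^]\<^bsub>G\<^esub> k g \<otimes>\<^bsub>G\<^esub> lincomb G A k = \<one>\<^bsub>G\<^esub>" "\<exists>b\<in>insert g A. k b \<noteq> 0"
    using assms False unfolding int_independent_iff_lincomb by auto
  have "k g \<noteq> 0"
  proof
    assume 0: "k g = 0"
    then have "lincomb G A k = \<one>\<^bsub>G\<^esub>" using k(1) assms by simp
    then have "\<forall>b\<in>A. k b = 0" using assms(5) unfolding int_independent_iff_lincomb by blast
    with 0 k(2) show False by auto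
  qed
  moreover have "g [^]\<^bsub>G\<^esub> k g = lincomb G A (\<lambda>a. k a * -1)"
  proof -
    have "g [^]\<^bsub>G\<^esub> k g = inv\<^bsub>G\<^esub> (lincomb G A k)"
      using k(1) g assms by (metis inv_equality int_pow_closed lincomb_closed)
    also have "\<dots> = lincomb G A k [^]\<^bsub>G\<^esub> (-1::int)"
      using assms by (metis int_pow_neg int_pow_1 lincomb_closed)
    finally show ?thesis using assms by (simp add: lincomb_int_pow)
  qed
  ultimately show ?thesis by blast
qed

text \<open>
  Rank-nullity: maximal independent sets \<open>P\<close> of the kernel and \<open>Q\<close> of the
  quotient combine, after lifting \<open>Q\<close> along \<open>f\<close>, to a maximal independent set
  of the middle group.
\<close>
lemma has_rank_extension:
  assumes A: "comm_group A" and G: "comm_group G" and C: "comm_group C"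
    and i: "i \<in> hom A G" "inj_on i (carrier A)" and f: "f \<in> hom G C" "f ` carrier G = carrier C"
    and exact: "i ` carrier A = kernel G C f"
    and ra: "has_rank A a" and rc: "has_rank C c"
  shows "has_rank G (a + c)"
proof -
  interpret A: comm_group A by fact
  interpret G: comm_group G by fact
  interpret C: comm_group C by fact
  interpret i: group_hom A G i using i by unfold_locales
  interpret f: group_hom G C f using f by unfold_locales
  obtain P where P: "finite P" "P \<subseteq> carrier A" "int_independent A P" "card P = a"
    using ra unfolding has_rank_def by blast
  obtain Q where Q: "finite Q" "Q \<subseteq> carrier C" "int_independent C Q" "card Q = c"
    using rc unfolding has_rank_def by blast
  obtain s where s: "\<And>y. y \<in> Q \<Longrightarrow> s y \<in> carrier G \<and> f (s y) = y"
  proof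
    fix y assume "y \<in> Q"
    then have "y \<in> f ` carrier G" using f(2) Q(2) by auto
    then show "inv_into (carrier G) f y \<in> carrier G \<and> f (inv_into (carrier G) f y) = y"
      by (simp add: inv_into_into f_inv_into_f)
  qed
  have fi: "f (i x) = \<one>\<^bsub>C\<^esub>" if "x \<in> carrier A" for x
    using exact that unfolding kernel_def by auto
  have iP: "finite (i ` P)" "i ` P \<subseteq> carrier G" using P by auto
  have sQ: "finite (s ` Q)" "s ` Q \<subseteq> carrier G" using Q s by auto
  have inj_s: "inj_on s Q" by (rule inj_on_inverseI[of _ f]) (use s in auto)
  have inj_i: "inj_on i P" using inj_on_subset[OF i(2) P(2)] .
  have inj_f: "inj_on f (s ` Q)" by (rule inj_on_inverseI[of _ s]) (use s in auto)
  have fsQ: "f ` s ` Q = Q" using s by force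
  have disj: "i ` P \<inter> s ` Q = {}"
  proof -
    have "f (s q) \<noteq> \<one>\<^bsub>C\<^esub>" if "q \<in> Q" for q
      using C.independent_not_one[OF Q(1-3) that] s[OF that] by simp
    then show ?thesis using fi P(2) by force
  qed
  have f_lin: "f (lincomb G (s ` Q) k) = lincomb C Q (\<lambda>q. k (s q))" for k
  proof -
    have "f (lincomb G (s ` Q) k) = f (lincomb G (s ` Q) (\<lambda>x. k (s (f x))))"
      using sQ s by (intro arg_cong[where f = f] G.lincomb_cong) auto
    also have "\<dots> = lincomb C (f ` s ` Q) (\<lambda>q. k (s q))"
      using lincomb_hom[OF G C f(1) sQ inj_f, of "\<lambda>q. k (s q)"] by simp
    finally show ?thesis by (simp only: fsQ)
  qed
  have i_lin: "lincomb G (i ` P) k = i (lincomb A P (\<lambda>p. k (i p)))" for k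
    using lincomb_hom[OF A G i(1) P(1,2) inj_i] .
  let ?R = "i ` P \<union> s ` Q"
  have R_lin: "lincomb G ?R k = lincomb G (i ` P) k \<otimes>\<^bsub>G\<^esub> lincomb G (s ` Q) k" for k
    using G.lincomb_Un iP sQ disj by blast
  have card_R: "card ?R = a + c"
    using iP sQ disj P(4) Q(4) inj_i inj_s by (simp add: card_Un_disjoint card_image)
  have ind_R: "int_independent G ?R"
    unfolding int_independent_iff_lincomb
  proof (intro allI impI)
    fix k assume k: "lincomb G ?R k = \<one>\<^bsub>G\<^esub>"
    have "f (lincomb G ?R k) = f (lincomb G (i ` P) k) \<otimes>\<^bsub>C\<^esub> f (lincomb G (s ` Q) k)"
      unfolding R_lin using iP sQ by simp
    moreover have "f (lincomb G (i ` P) k) = \<one>\<^bsub>C\<^esub>"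
      using P by (simp add: i_lin fi)
    ultimately have "lincomb C Q (\<lambda>q. k (s q)) = \<one>\<^bsub>C\<^esub>"
      using k Q by (simp add: f_lin)
    then have 0: "\<forall>q\<in>Q. k (s q) = 0"
      using Q(3) unfolding int_independent_iff_lincomb by blast
    have "lincomb G (s ` Q) k = lincomb G (s ` Q) (\<lambda>_. 0)"
      using sQ 0 by (intro G.lincomb_cong) auto
    then have "i (lincomb A P (\<lambda>p. k (i p))) = i \<one>\<^bsub>A\<^esub>"
      using k R_lin[of k] sQ iP P by (simp add: G.lincomb_zero flip: i_lin)
    then have "lincomb A P (\<lambda>p. k (i p)) = \<one>\<^bsub>A\<^esub>"
      using P(2) by (intro inj_onD[OF i(2)]) auto
    then have "\<forall>p\<in>P. k (i p) = 0"
      using P(3) unfolding int_independent_iff_lincomb by blast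
    with 0 show "\<forall>b\<in>?R. k b = 0" by blast
  qed
  have span_R: "\<exists>d k. d \<noteq> 0 \<and> g [^]\<^bsub>G\<^esub> (d::int) = lincomb G ?R k" if g: "g \<in> carrier G" for g
  proof -
    obtain d k where dk: "d \<noteq> 0" "f g [^]\<^bsub>C\<^esub> (d::int) = lincomb C Q k"
      using maximal_independent_spans[OF C _ Q(1-3), of "f g"] rc Q(4) g by auto
    \<comment> \<open>\<open>y\<close> corrects a multiple of \<open>g\<close> to an element of the kernel.\<close>
    define y where "y = lincomb G (s ` Q) (\<lambda>x. k (f x))"
    have y: "y \<in> carrier G" unfolding y_def using sQ by simp
    have "f y = lincomb C Q k"
      unfolding y_def f_lin using s Q by (intro C.lincomb_cong) auto
    then have "g [^]\<^bsub>G\<^esub> d \<otimes>\<^bsub>G\<^esub> inv\<^bsub>G\<^esub> y \<in> kernel G C f"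
      using g y dk Q by (simp add: kernel_def f.hom_int_pow)
    then obtain x where x: "x \<in> carrier A" "i x = g [^]\<^bsub>G\<^esub> d \<otimes>\<^bsub>G\<^esub> inv\<^bsub>G\<^esub> y"
      unfolding exact[symmetric] by auto
    obtain e l where el: "e \<noteq> 0" "x [^]\<^bsub>A\<^esub> (e::int) = lincomb A P l"
      using maximal_independent_spans[OF A _ P(1-3) x(1)] ra P(4) by auto
    have "g [^]\<^bsub>G\<^esub> d = i x \<otimes>\<^bsub>G\<^esub> y"
      using x(2) g y by (simp add: G.m_assoc)
    then have "g [^]\<^bsub>G\<^esub> (d * e) = i (x [^]\<^bsub>A\<^esub> e) \<otimes>\<^bsub>G\<^esub> y [^]\<^bsub>G\<^esub> e"
      using g x(1) y by (simp add: G.int_pow_pow[symmetric] G.int_pow_distrib i.hom_int_pow)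
    also have "i (x [^]\<^bsub>A\<^esub> e) = lincomb G (i ` P) (\<lambda>z. l (inv_into P i z))"
    proof -
      have "lincomb A P l = lincomb A P (\<lambda>p. l (inv_into P i (i p)))"
        using P(2) inj_i by (intro A.lincomb_cong) auto
      then show ?thesis unfolding el(2) i_lin by simp
    qed
    also have "y [^]\<^bsub>G\<^esub> e = lincomb G (s ` Q) (\<lambda>x. k (f x) * e)"
      unfolding y_def using sQ by (simp add: G.lincomb_int_pow)
    also have "lincomb G (i ` P) (\<lambda>z. l (inv_into P i z)) \<otimes>\<^bsub>G\<^esub> lincomb G (s ` Q) (\<lambda>x. k (f x) * e)
        = lincomb G ?R (\<lambda>z. if z \<in> i ` P then l (inv_into P i z) else k (f z) * e)"
    proof -
      have "lincomb G (i ` P) (\<lambda>z. if z \<in> i ` P then l (inv_into P i z) else k (f z) * e)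
          = lincomb G (i ` P) (\<lambda>z. l (inv_into P i z))"
        using iP by (intro G.lincomb_cong) auto
      moreover have "lincomb G (s ` Q) (\<lambda>z. if z \<in> i ` P then l (inv_into P i z) else k (f z) * e)
          = lincomb G (s ` Q) (\<lambda>x. k (f x) * e)"
        using sQ disj by (intro G.lincomb_cong) auto
      ultimately show ?thesis unfolding R_lin by simp
    qed
    finally show ?thesis using dk(1) el(1) by (metis mult_eq_0_iff)
  qed
  have "card B \<le> a + c" if "finite B" "B \<subseteq> carrier G" "int_independent G B" for B
  proof -
    have "card B \<le> card ?R"
      using iP sQ that span_R by (intro G.card_independent_le) auto
    then show ?thesis by (simp add: card_R)
  qed
  then show ?thesis
    unfolding has_rank_def using iP sQ ind_R card_R
    by (intro conjI exI[of _ ?R]) simp_all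
qed

text \<open>
  The form of rank-nullity used on long exact sequences, where the kernel is the unknown group. Its
  rank exists because its independent sets inject into the middle group.
\<close>
lemma has_rank_kernel:
  assumes A: "comm_group A" and G: "comm_group G" and C: "comm_group C"
    and i: "i \<in> hom A G" "inj_on i (carrier A)" and f: "f \<in> hom G C" "f ` carrier G = carrier C"
    and exact: "i ` carrier A = kernel G C f"
    and rg: "has_rank G r" and rc: "has_rank C c"
  shows "has_rank A (r - c)"
proof -
  have "card B \<le> r" if B: "finite B" "B \<subseteq> carrier A" "int_independent A B" for B
  proof -
    have "card (i ` B) = card B" using inj_on_subset[OF i(2) B(2)] by (rule card_image)
    moreover have "i ` B \<subseteq> carrier G" using i(1) B(2) by (auto simp: hom_def)
    ultimately show ?thesis
      using has_rank_upper[OF rg finite_imageI[OF B(1)] _ independent_image[OF A G i(1) B(1,2) i(2) B(3)]]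
      by simp
  qed
  then obtain a where a: "has_rank A a" using has_rank_if_bounded by blast
  have "r = a + c"
    using has_rank_unique[OF rg has_rank_extension[OF A G C i f exact a rc]] .
  with a show ?thesis by simp
qed

lemma has_rank_free_Abelian_group:
  assumes "finite S"
  shows "has_rank (free_Abelian_group S) (card S)"
proof -
  let ?F = "free_Abelian_group S"
  interpret comm_group ?F by (rule abelian_free_Abelian_group)
  let ?B = "frag_of ` S"
  have inj: "inj_on frag_of S" by (auto intro: inj_onI simp: frag_of_eq)
  have B: "finite ?B" "?B \<subseteq> carrier ?F" using assms by auto
  have lin: "lincomb ?F (frag_of ` T) k = (\<Sum>a\<in>T. frag_cmul (k (frag_of a)) (frag_of a))"
    if "T \<subseteq> S" for T k
    using finite_subset[OF that assms] that
  proof (induction T rule: finite_induct)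
    case (insert a T)
    then have "frag_of a \<notin> frag_of ` T" by (auto simp: frag_of_eq)
    moreover have "frag_of ` T \<subseteq> carrier ?F" using insert by auto
    ultimately show ?case using insert by simp
  qed simp
  have look: "poly_mapping.lookup (lincomb ?F ?B k) a = k (frag_of a)" if "a \<in> S" for k a
  proof -
    have "poly_mapping.lookup (lincomb ?F ?B k) a
        = (\<Sum>b\<in>S. if b = a then k (frag_of b) else 0)"
      by (auto simp: lin lookup_sum intro!: sum.cong)
    then show ?thesis using assms that by simp
  qed
  have ind: "int_independent ?F ?B"
    unfolding int_independent_iff_lincomb
  proof (intro allI impI ballI)
    fix k b assume "lincomb ?F ?B k = \<one>\<^bsub>?F\<^esub>" "b \<in> ?B"
    then show "k b = 0" using look[of _ k] by auto
  qed
  have "\<exists>d k. d \<noteq> 0 \<and> g [^]\<^bsub>?F\<^esub> (d::int) = lincomb ?F ?B k" if g: "g \<in> carrier ?F" for g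
  proof -
    have "g = lincomb ?F ?B (\<lambda>x. poly_mapping.lookup g (inv_into S frag_of x))"
    proof (rule poly_mapping_eqI)
      fix a
      show "poly_mapping.lookup g a
        = poly_mapping.lookup (lincomb ?F ?B (\<lambda>x. poly_mapping.lookup g (inv_into S frag_of x))) a"
      proof (cases "a \<in> S")
        case True
        then show ?thesis by (simp only: look inv_into_f_f[OF inj True])
      next
        case False
        then have "a \<notin> Poly_Mapping.keys g" using g by auto
        moreover have "a \<notin> Poly_Mapping.keys (lincomb ?F ?B k)" for k
          using lincomb_closed[OF B(2), of k] False by auto
        ultimately show ?thesis by (simp add: in_keys_iff)
      qed
    qed
    then show ?thesis using g by (metis int_pow_1 one_neq_zero)
  qed
  then have "card B' \<le> card ?B" if "finite B'" "B' \<subseteq> carrier ?F" "int_independent ?F B'" for B'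
    using that B by (intro card_independent_le) auto
  then show ?thesis
    unfolding has_rank_def using B ind card_image[OF inj]
    by (intro conjI exI[of _ ?B]) simp_all
qed

section \<open>Homology of a space glued from contractible pieces\<close>

text \<open>
  The pieces are the components of \<open>Y\<close>; being open, disjoint and contractible they make
  \<open>Y\<close> homotopy equivalent to a discrete space with one point for each piece.
\<close>
definition contractible_decomposition :: "'a topology \<Rightarrow> 'a set set \<Rightarrow> bool" where
  "contractible_decomposition Y \<V> \<longleftrightarrow>
     finite \<V> \<and> disjoint \<V> \<and> \<Union>\<V> = topspace Y \<and>
     (\<forall>v\<in>\<V>. openin Y v \<and> v \<noteq> {} \<and> contractible_space (subtopology Y v))"

lemma trivial_homology_contractible:
  assumes "contractible_space X" "p \<noteq> 0"
  shows "trivial_group (homology_group p X)"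
  using assms trivial_reduced_homology_group_contractible_space[of X p]
  by (simp add: un_reduced_homology_group)

lemma homology_contractible_decomposition:
  assumes "contractible_decomposition Y \<V>"
  shows "sum_group \<V> (\<lambda>v. homology_group p (subtopology Y v)) \<cong> homology_group p Y"
  using assms unfolding contractible_decomposition_def
  by (intro is_isoI[OF homology_additivity_axiom]) auto

lemma trivial_sum_group:
  assumes "\<And>i. i \<in> I \<Longrightarrow> group (G i)" "\<And>i. i \<in> I \<Longrightarrow> trivial_group (G i)"
  shows "trivial_group (sum_group I G)"
proof -
  have "carrier (sum_group I G) = {\<one>\<^bsub>sum_group I G\<^esub>}"
  proof (intro equalityI subsetI)
    fix x assume "x \<in> carrier (sum_group I G)"
    then have "x \<in> (\<Pi>\<^sub>E i\<in>I. carrier (G i))"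
      using assms(1) by (simp add: carrier_sum_group)
    then have "x = (\<lambda>i\<in>I. \<one>\<^bsub>G i\<^esub>)"
      using assms(2) by (intro ext) (auto simp: trivial_group_def PiE_iff extensional_def)
    then show "x \<in> {\<one>\<^bsub>sum_group I G\<^esub>}" by simp
  next
    fix x assume "x \<in> {\<one>\<^bsub>sum_group I G\<^esub>}"
    then show "x \<in> carrier (sum_group I G)"
      using monoid.one_closed[OF group.is_monoid[OF sum_group[of I G]]] assms(1) by simp
  qed
  then show ?thesis using assms(1) by (simp add: trivial_group_def)
qed

lemma higher_homology_decomposition:
  assumes "contractible_decomposition Y \<V>" "p \<noteq> 0"
  shows "trivial_group (homology_group p Y)"
proof (rule isomorphic_group_triviality1[OF homology_contractible_decomposition[OF assms(1)]])
  show "trivial_group (sum_group \<V> (\<lambda>v. homology_group p (subtopology Y v)))"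
    using assms by (intro trivial_sum_group trivial_homology_contractible)
      (auto simp: contractible_decomposition_def)
qed simp

lemma rank_zeroth_homology_decomposition:
  assumes "contractible_decomposition Y \<V>"
  shows "has_rank (homology_group 0 Y) (card \<V>)"
proof -
  have "sum_group \<V> (\<lambda>v. homology_group 0 (subtopology Y v)) \<cong> sum_group \<V> (\<lambda>_. integer_group)"
  proof (rule iso_sum_groupI)
    fix v assume v: "v \<in> \<V>"
    then have "contractible_space (subtopology Y v)" "topspace (subtopology Y v) \<noteq> {}"
      using assms unfolding contractible_decomposition_def
      by (auto simp: openin_subset inf_absorb2)
    then show "homology_group 0 (subtopology Y v) \<cong> integer_group"
      by (intro isomorphic_integer_zeroth_homology_group contractible_imp_path_connected_space)
  qed auto
  also have "\<dots> \<cong> free_Abelian_group \<V>"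
    by (rule isomorphic_sum_integer_group)
  finally have "free_Abelian_group \<V> \<cong> sum_group \<V> (\<lambda>v. homology_group 0 (subtopology Y v))"
    by (rule group.iso_sym[rotated]) simp
  also have "\<dots> \<cong> homology_group 0 Y"
    by (rule homology_contractible_decomposition[OF assms])
  finally show ?thesis
    using assms has_rank_iso[OF abelian_free_Abelian_group abelian_homology_group _ has_rank_free_Abelian_group]
    unfolding contractible_decomposition_def by blast
qed

lemma rank_zeroth_homology_path_connected:
  assumes "path_connected_space X" "topspace X \<noteq> {}"
  shows "has_rank (homology_group 0 X) 1"
proof -
  have "free_Abelian_group {()} \<cong> integer_group"
    using isomorphic_group_integer_free_Abelian_group_singleton
    by (rule group.iso_sym[rotated]) simp
  also have "\<dots> \<cong> homology_group 0 X"
    using isomorphic_integer_zeroth_homology_group[OF assms] by (rule group.iso_sym[rotated]) simp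
  finally show ?thesis
    using has_rank_iso[OF abelian_free_Abelian_group abelian_homology_group _ has_rank_free_Abelian_group]
    by fastforce
qed

lemma comm_group_reduced_homology: "comm_group (reduced_homology_group p X)"
  unfolding reduced_homology_group_def
  by (rule group.abelian_subgroup_generated) simp_all

text \<open>
  The augmentation to the homology of a point is onto because a point of \<open>Y\<close> splits it;
  reduced homology is its kernel.
\<close>
lemma rank_reduced_homology:
  assumes "has_rank (homology_group 0 Y) r" "topspace Y \<noteq> {}"
  shows "has_rank (reduced_homology_group 0 Y) (r - 1)"
proof -
  let ?pt = "discrete_topology {()}"
  let ?f = "hom_induced 0 Y {} ?pt {} (\<lambda>x. ())"
  obtain a where a: "a \<in> topspace Y" using assms(2) by blast
  have f: "?f \<in> hom (homology_group 0 Y) (homology_group 0 ?pt)" by (rule hom_induced_hom)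
  have surj: "?f ` carrier (homology_group 0 Y) = carrier (homology_group 0 ?pt)"
  proof
    show "?f ` carrier (homology_group 0 Y) \<subseteq> carrier (homology_group 0 ?pt)"
      using f by (auto simp: hom_def)
    show "carrier (homology_group 0 ?pt) \<subseteq> ?f ` carrier (homology_group 0 Y)"
    proof
      fix x assume x: "x \<in> carrier (homology_group 0 ?pt)"
      let ?g = "hom_induced 0 ?pt {} Y {} (\<lambda>_. a)"
      have "?f (?g x) = hom_induced 0 ?pt {} ?pt {} ((\<lambda>x. ()) \<circ> (\<lambda>_. a)) x"
        using a by (intro hom_induced_compose') auto
      also have "\<dots> = x"
        using x by (intro hom_induced_id_gen) auto
      finally have "?f (?g x) = x" .
      moreover have "?g x \<in> carrier (homology_group 0 Y)"
        using x hom_induced_hom by (metis hom_in_carrier)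
      ultimately show "x \<in> ?f ` carrier (homology_group 0 Y)" by (metis imageI)
    qed
  qed
  have "carrier (reduced_homology_group 0 Y) \<subseteq> carrier (homology_group 0 Y)"
    by (rule carrier_reduced_homology_group_subset)
  then have "id \<in> hom (reduced_homology_group 0 Y) (homology_group 0 Y)"
    by (auto simp: hom_def reduced_homology_group_def)
  then show ?thesis
    using surj f assms(1)
    by (intro has_rank_kernel[where i = id and f = ?f and G = "homology_group 0 Y"
          and C = "homology_group 0 ?pt" and r = r])
      (simp_all add: comm_group_reduced_homology carrier_reduced_homology_group
        rank_zeroth_homology_path_connected[of ?pt, simplified] path_connected_space_discrete_topology)
qed

text \<open>
  The class of a single point generates the infinite cyclic group \<open>H\<^sub>0(X)\<close>, and the
  augmentation carries it to a generator of the infinite cyclic group \<open>H\<^sub>0\<close> of a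
  point, so the augmentation is injective.
\<close>
lemma trivial_reduced_homology_path_connected:
  assumes "path_connected_space X" "topspace X \<noteq> {}"
  shows "trivial_group (reduced_homology_group 0 X)"
proof -
  let ?pt = "discrete_topology {()}"
  let ?f = "hom_induced 0 X {} ?pt {} (\<lambda>x. ())"
  obtain a where a: "a \<in> topspace X" using assms(2) by blast
  define s where "s = restrict (\<lambda>x. a) (standard_simplex 0)"
  have s: "singular_simplex 0 X s"
    by (simp add: s_def singular_simplex_def a)
  let ?q = "homologous_rel_set 0 X {} (frag_of s)"
  define t where "t = simplex_map 0 (\<lambda>x. ()) s"
  have t: "singular_simplex 0 ?pt t"
    unfolding t_def using s by (rule singular_simplex_simplex_map) simp
  have srs: "singular_relcycle 0 X {} (frag_of s)"
    by (simp add: chain_boundary_def s singular_chain_of singular_cycle)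
  have fq: "?f ?q = homologous_rel_set 0 ?pt {} (frag_of t)"
    using hom_induced_chain_map[of X ?pt "\<lambda>x. ()" "{}" "{}" 0 "frag_of s"] srs
    by (simp add: t_def chain_map_of)
  have qc: "?q \<in> carrier (homology_group 0 X)"
    using srs by (simp add: carrier_relative_homology_group_0)
  have isoX: "pow (homology_group 0 X) ?q \<in> iso integer_group (homology_group 0 X)"
    by (rule iso_integer_zeroth_homology_group[OF assms(1) s])
  have isopt: "pow (homology_group 0 ?pt) (?f ?q) \<in> iso integer_group (homology_group 0 ?pt)"
    unfolding fq
    by (rule iso_integer_zeroth_homology_group[OF _ t]) (simp add: path_connected_space_discrete_topology)
  interpret X: comm_group "homology_group 0 X" by simp
  interpret P: comm_group "homology_group 0 ?pt" by simp
  interpret f: group_hom "homology_group 0 X" "homology_group 0 ?pt" ?f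
    by unfold_locales (rule hom_induced_hom)
  have "x = \<one>\<^bsub>homology_group 0 X\<^esub>"
    if x: "x \<in> carrier (homology_group 0 X)" "?f x = \<one>\<^bsub>homology_group 0 ?pt\<^esub>" for x
  proof -
    obtain m :: int where m: "x = ?q [^]\<^bsub>homology_group 0 X\<^esub> m"
      using isoX x(1) unfolding iso_def bij_betw_def by auto
    have "?f ?q [^]\<^bsub>homology_group 0 ?pt\<^esub> m = ?f ?q [^]\<^bsub>homology_group 0 ?pt\<^esub> (0::int)"
      using x(2) qc unfolding m by (simp add: f.hom_int_pow)
    moreover have "inj (pow (homology_group 0 ?pt) (?f ?q) :: int \<Rightarrow> _)"
      using isopt unfolding iso_def bij_betw_def by simp
    ultimately have "m = 0" by (meson injD)
    then show ?thesis using m by simp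
  qed
  then have "carrier (reduced_homology_group 0 X) = {\<one>\<^bsub>reduced_homology_group 0 X\<^esub>}"
    by (auto simp: carrier_reduced_homology_group kernel_def one_reduced_homology_group)
  then show ?thesis by (simp add: trivial_group_def)
qed

text \<open>
  Excising the complement of \<open>U\<close> and using that \<open>U\<close> is contractible gives
  \<open>H\<^sub>p(X, V)\<close> \<open>\<cong>\<close> \<open>H\<^sub>p(U, U \<inter> V)\<close>
  \<open>\<cong>\<close> reduced \<open>H\<^sub>p\<^sub>-\<^sub>1(U \<inter> V)\<close>, which vanishes
  for \<open>p \<ge> 2\<close> and has rank \<open>card \<W> - 1\<close> for \<open>p = 1\<close>. The
  higher homology of \<open>V\<close> vanishes as well, so the sequence of the pair
  \<open>(X, V)\<close> kills \<open>H\<^sub>p(X)\<close> for \<open>p \<ge> 2\<close> and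
  reduces in degree one to a short exact sequence from \<open>H\<^sub>1(X)\<close> over
  \<open>H\<^sub>1(X, V)\<close> to reduced \<open>H\<^sub>0(V)\<close>, of rank \<open>card \<V> - 1\<close>.
\<close>
theorem ranks_of_cover:
  assumes X: "path_connected_space X" "topspace X \<noteq> {}"
    and U: "openin X U" "contractible_space (subtopology X U)"
    and V: "openin X V" "contractible_decomposition (subtopology X V) \<V>" "V \<noteq> {}"
    and W: "contractible_decomposition (subtopology X (U \<inter> V)) \<W>" "U \<inter> V \<noteq> {}"
    and cover: "U \<union> V = topspace X"
  shows "has_rank (homology_group 0 X) 1"
    and "has_rank (homology_group 1 X) (card \<W> - 1 - (card \<V> - 1))"
    and "p \<ge> 2 \<Longrightarrow> has_rank (homology_group p X) 0"
proof -
  show "has_rank (homology_group 0 X) 1"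
    using rank_zeroth_homology_path_connected[OF X] .
  have XUV: "subtopology (subtopology X V) V = subtopology X V"
    "subtopology (subtopology X U) (U \<inter> V) = subtopology X (U \<inter> V)"
    by (simp_all add: subtopology_subtopology)
  have sub: "U \<subseteq> topspace X" "V \<subseteq> topspace X"
    using U V openin_subset by auto
  have rel: "relative_homology_group p X V \<cong> reduced_homology_group (p - 1) (subtopology X (U \<inter> V))" for p
  proof -
    let ?K = "topspace X - U"
    have "closedin X ?K" using U(1) by blast
    then have "X closure_of ?K \<subseteq> X interior_of V"
      using cover V(1) by (auto simp: closure_of_closedin interior_of_openin)
    then have "hom_induced p (subtopology X (topspace X - ?K)) (V - ?K) (subtopology X (topspace X)) V id
      \<in> iso (relative_homology_group p (subtopology X (topspace X - ?K)) (V - ?K))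
          (relative_homology_group p (subtopology X (topspace X)) V)"
      using sub by (rule_tac homology_excision_axiom) auto
    moreover have "topspace X - ?K = U" "V - ?K = U \<inter> V" using sub by auto
    ultimately have "relative_homology_group p (subtopology X U) (U \<inter> V) \<cong> relative_homology_group p X V"
      by (simp add: is_isoI)
    then have "relative_homology_group p X V \<cong> relative_homology_group p (subtopology X U) (U \<inter> V)"
      by (rule group.iso_sym[rotated]) simp
    also have "\<dots> \<cong> reduced_homology_group (p - 1) (subtopology X (U \<inter> V))"
      using isomorphic_group_relative_homology_of_contractible[OF U(2), of "U \<inter> V" p] W(2) sub XUV(2)
      by (metis Int_absorb1 Int_assoc Int_commute inf_le1 topspace_subtopology)
    finally show ?thesis .
  qed
  have ne: "topspace X \<inter> V \<noteq> {}" using V(3) sub by auto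
  show "has_rank (homology_group 1 X) (card \<W> - 1 - (card \<V> - 1))"
  proof -
    have rW: "has_rank (reduced_homology_group 0 (subtopology X (U \<inter> V))) (card \<W> - 1)"
      using rank_reduced_homology[OF rank_zeroth_homology_decomposition[OF W(1)]] W(2) sub by auto
    have rV: "has_rank (reduced_homology_group 0 (subtopology X V)) (card \<V> - 1)"
      using rank_reduced_homology[OF rank_zeroth_homology_decomposition[OF V(2)]] V(3) sub by auto
    have rXV: "has_rank (relative_homology_group 1 X V) (card \<W> - 1)"
    proof -
      have "relative_homology_group 1 X V \<cong> reduced_homology_group 0 (subtopology X (U \<inter> V))"
        using rel[of 1] by simp
      then have "reduced_homology_group 0 (subtopology X (U \<inter> V)) \<cong> relative_homology_group 1 X V"
        by (rule group.iso_sym[OF group_relative_homology_group])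
      from has_rank_iso[OF comm_group_reduced_homology abelian_relative_homology_group this rW]
      show ?thesis .
    qed
    let ?j = "hom_induced 1 X {} X V id" and ?d = "hom_boundary 1 X V"
    have e1: "exact_seq ([reduced_homology_group 0 (subtopology X V), relative_homology_group 1 X V,
        reduced_homology_group 1 X], [?d, ?j])"
      using homology_exactness_reduced_1[OF ne, of 1] by simp
    have e2: "exact_seq ([reduced_homology_group 0 X, reduced_homology_group 0 (subtopology X V),
        relative_homology_group 1 X V], [hom_induced 0 (subtopology X V) {} X {} id, ?d])"
      using homology_exactness_reduced_2[of 1 X V] by simp
    have e3: "exact_seq ([relative_homology_group 1 X V, homology_group 1 X,
        homology_group 1 (subtopology X V)], [?j, hom_induced 1 (subtopology X V) {} X {} id])"
      by (rule homology_exactness_axiom_3)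
    have 1: "reduced_homology_group 1 X = homology_group 1 X"
      by (simp add: un_reduced_homology_group)
    show ?thesis
    proof (rule has_rank_kernel[OF _ _ _ _ _ _ _ _ rXV rV])
      show "?j \<in> hom (homology_group 1 X) (relative_homology_group 1 X V)"
        by (rule hom_induced_hom)
      interpret j: group_hom "homology_group 1 X" "relative_homology_group 1 X V" ?j
        by (simp add: group_hom_def group_hom_axioms_def hom_induced_hom)
      have "kernel (homology_group 1 X) (relative_homology_group 1 X V) ?j
          = hom_induced 1 (subtopology X V) {} X {} id ` carrier (homology_group 1 (subtopology X V))"
        using e3 by simp
      also have "\<dots> = {\<one>\<^bsub>homology_group 1 X\<^esub>}"
        using higher_homology_decomposition[OF V(2), of 1] hom_one[OF hom_induced_hom]
        by (simp add: trivial_group_def)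
      finally show "inj_on ?j (carrier (homology_group 1 X))"
        by (rule j.trivial_ker_imp_inj)
      show "?d \<in> hom (relative_homology_group 1 X V) (reduced_homology_group 0 (subtopology X V))"
        using hom_boundary_reduced_hom[of 1 X V] by simp
      have "?d ` carrier (relative_homology_group 1 X V) =
        kernel (reduced_homology_group 0 (subtopology X V)) (reduced_homology_group 0 X)
          (hom_induced 0 (subtopology X V) {} X {} id)"
        using e2 by simp
      also have "\<dots> = carrier (reduced_homology_group 0 (subtopology X V))"
      proof (rule group_hom.kernel_to_trivial_group)
        show "group_hom (reduced_homology_group 0 (subtopology X V)) (reduced_homology_group 0 X)
          (hom_induced 0 (subtopology X V) {} X {} id)"
          by (simp add: group_hom_def group_hom_axioms_def hom_induced_reduced_hom)
        show "trivial_group (reduced_homology_group 0 X)"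
          by (rule trivial_reduced_homology_path_connected[OF X])
      qed
      finally show "?d ` carrier (relative_homology_group 1 X V)
        = carrier (reduced_homology_group 0 (subtopology X V))" .
      show "?j ` carrier (homology_group 1 X)
        = kernel (relative_homology_group 1 X V) (reduced_homology_group 0 (subtopology X V)) ?d"
        using e1 unfolding 1 by simp
    qed (simp_all add: comm_group_reduced_homology)
  qed
  show "has_rank (homology_group p X) 0" if p: "p \<ge> 2"
  proof (rule has_rank_trivial)
    have "trivial_group (reduced_homology_group (p - 1) (subtopology X (U \<inter> V)))"
      using higher_homology_decomposition[OF W(1), of "p - 1"] p
      by (simp add: un_reduced_homology_group)
    then have triv: "trivial_group (relative_homology_group p X V)"
      using rel[of p] by (simp add: isomorphic_group_triviality)
    have e3: "exact_seq ([relative_homology_group p X V, homology_group p X,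
        homology_group p (subtopology X V)],
        [hom_induced p X {} X V id, hom_induced p (subtopology X V) {} X {} id])"
      by (rule homology_exactness_axiom_3)
    have "carrier (homology_group p X)
        = kernel (homology_group p X) (relative_homology_group p X V) (hom_induced p X {} X V id)"
    proof (rule group_hom.kernel_to_trivial_group[symmetric])
      show "group_hom (homology_group p X) (relative_homology_group p X V) (hom_induced p X {} X V id)"
        by (simp add: group_hom_def group_hom_axioms_def hom_induced_hom)
    qed (rule triv)
    also have "\<dots> = hom_induced p (subtopology X V) {} X {} id ` carrier (homology_group p (subtopology X V))"
      using e3 by simp
    also have "\<dots> = {\<one>\<^bsub>homology_group p X\<^esub>}"
      using higher_homology_decomposition[OF V(2), of p] hom_one[OF hom_induced_hom] p
      by (simp add: trivial_group_def)
    finally show "trivial_group (homology_group p X)" by (simp add: trivial_group_def)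
  qed simp
qed

theorem euler_characteristic_of_cover:
  assumes X: "path_connected_space X" "topspace X \<noteq> {}"
    and U: "openin X U" "contractible_space (subtopology X U)"
    and V: "openin X V" "contractible_decomposition (subtopology X V) \<V>" "V \<noteq> {}"
    and W: "contractible_decomposition (subtopology X (U \<inter> V)) \<W>" "U \<inter> V \<noteq> {}"
    and cover: "U \<union> V = topspace X" and le: "card \<V> \<le> card \<W>"
  shows "euler_characteristic X = 1 + int (card \<V>) - int (card \<W>)"
proof -
  let ?r = "\<lambda>p::nat. abelian_rank (homology_group (int p) X)"
  note ranks = ranks_of_cover[OF X U V W cover]
  have "card \<V> \<ge> 1" "card \<W> \<ge> 1"
    using V W openin_subset[OF V(1)] openin_subset[OF U(1)] unfolding contractible_decomposition_def
    by (auto simp: Suc_le_eq card_gt_0_iff)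
  then have r1: "int (?r 1) = int (card \<W>) - int (card \<V>)"
    using abelian_rank_eq[OF ranks(2)] le by simp
  have r0: "?r 0 = 1" using abelian_rank_eq[OF ranks(1)] by simp
  have r2: "?r p = 0" if "p \<ge> 2" for p
    using abelian_rank_eq[OF ranks(3)[of "int p"]] that by simp
  have "{p. ?r p \<noteq> 0} \<subseteq> {0, 1}"
  proof
    fix p assume "p \<in> {p. ?r p \<noteq> 0}"
    then have "?r p \<noteq> 0" by simp
    then have "p < 2" using r2[of p] by linarith
    then show "p \<in> {0, 1}" by (simp add: less_2_cases)
  qed
  then have "euler_characteristic X = (\<Sum>p\<in>{0, 1::nat}. (- 1) ^ p * int (?r p))"
    unfolding euler_characteristic_def by (intro sum.mono_neutral_left) auto
  then show ?thesis using r0 r1 by simp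
qed

section \<open>Real Moebius transformations of the half-plane\<close>

lemma in_H: "z \<in> upper_half_plane \<longleftrightarrow> Im z > 0"
  by (simp add: upper_half_plane_def)

lemma in_half_disc: "z \<in> half_disc c r \<longleftrightarrow> Im z > 0 \<and> cmod (z - of_real c) < r"
  by (auto simp: half_disc_def in_H dist_norm norm_minus_commute)

lemma in_half_disc_boundary:
  "z \<in> half_disc_boundary c r \<longleftrightarrow> Im z > 0 \<and> cmod (z - of_real c) = r"
  by (auto simp: half_disc_boundary_def in_H dist_norm norm_minus_commute)

lemma in_half_disc_exterior:
  "z \<in> half_disc_exterior c r \<longleftrightarrow> Im z > 0 \<and> cmod (z - of_real c) > r"
  by (auto simp: half_disc_exterior_def in_H dist_norm norm_minus_commute)

lemma open_upper_half_plane: "open upper_half_plane"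
  unfolding upper_half_plane_def by (rule open_halfspace_Im_gt)

lemma convex_upper_half_plane: "convex upper_half_plane"
  unfolding upper_half_plane_def by (rule convex_halfspace_Im_gt)

text \<open>
  Equality with the fractional linear map is required on the half-plane only, so that extensional
  maps and inverses formed with \<^const>\<open>inv_into\<close> qualify.
\<close>
definition real_moebius :: "(complex \<Rightarrow> complex) \<Rightarrow> bool" where
  "real_moebius f \<longleftrightarrow> (\<exists>a b c d :: real. a * d - b * c = 1 \<and>
     (\<forall>z\<in>upper_half_plane. f z = (of_real a * z + of_real b) / (of_real c * z + of_real d)))"

lemma PSL2R_real_moebius:
  assumes "f \<in> PSL2R"
  shows "real_moebius f"
proof -
  obtain A :: "real^2^2" where A: "det A = 1" "f = moebius A"
    using assms unfolding PSL2R_def by blast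
  then have "A $ 1 $ 1 * A $ 2 $ 2 - A $ 1 $ 2 * A $ 2 $ 1 = 1"
    by (simp add: det_2)
  then show ?thesis
    unfolding real_moebius_def A(2) moebius_def
    by (intro exI[of _ "A $ 1 $ 1"] exI[of _ "A $ 1 $ 2"] exI[of _ "A $ 2 $ 1"] exI[of _ "A $ 2 $ 2"])
       simp
qed

lemma moebius_denom_nonzero:
  fixes a b c d :: real
  assumes "a * d - b * c = 1" "z \<in> upper_half_plane"
  shows "of_real c * z + of_real d \<noteq> 0"
proof
  assume 0: "of_real c * z + of_real d = 0"
  from arg_cong[OF 0, of Im] have "c = 0" using assms(2) by (simp add: in_H)
  with 0 assms(1) show False by simp
qed

lemma moebius_diff:
  fixes a b c d :: real
  assumes "a * d - b * c = 1" "z \<in> upper_half_plane" "w \<in> upper_half_plane"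
  shows "(of_real a * z + of_real b) / (of_real c * z + of_real d)
       - (of_real a * w + of_real b) / (of_real c * w + of_real d)
       = (z - w) / ((of_real c * z + of_real d) * (of_real c * w + of_real d))"
proof -
  have "of_real a * of_real d - of_real b * of_real c = (1::complex)"
    using assms(1) by (metis of_real_1 of_real_diff of_real_mult)
  moreover have "(of_real a * z + of_real b) * (of_real c * w + of_real d)
      - (of_real a * w + of_real b) * (of_real c * z + of_real d)
      = (of_real a * of_real d - of_real b * of_real c) * (z - w)"
    by (simp add: algebra_simps)
  ultimately have "(of_real a * z + of_real b) * (of_real c * w + of_real d)
      - (of_real a * w + of_real b) * (of_real c * z + of_real d) = z - w"
    by (simp only: mult_1)
  then show ?thesis
    using moebius_denom_nonzero[OF assms(1)] assms(2,3) by (simp add: diff_frac_eq)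
qed

lemma moebius_Im:
  fixes a b c d :: real
  assumes "a * d - b * c = 1" "z \<in> upper_half_plane"
  shows "Im ((of_real a * z + of_real b) / (of_real c * z + of_real d))
       = Im z / (cmod (of_real c * z + of_real d))\<^sup>2"
proof -
  have "Im z * (a * d - b * c) / (cmod (of_real c * z + of_real d))\<^sup>2
    = Im ((of_real a * z + of_real b) / (of_real c * z + of_real d))"
    by (simp add: Im_divide cmod_power2 algebra_simps)
  then show ?thesis using assms(1) by simp
qed

lemma real_moebius_in_H:
  assumes "real_moebius f" "z \<in> upper_half_plane"
  shows "f z \<in> upper_half_plane"
proof -
  obtain a b c d :: real where m: "a * d - b * c = 1"
    "\<forall>z\<in>upper_half_plane. f z = (of_real a * z + of_real b) / (of_real c * z + of_real d)"
    using assms(1) unfolding real_moebius_def by blast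
  have "Im (f z) = Im z / (cmod (of_real c * z + of_real d))\<^sup>2"
    using m assms(2) moebius_Im by simp
  moreover have "cmod (of_real c * z + of_real d) > 0"
    using moebius_denom_nonzero[OF m(1) assms(2)] by simp
  ultimately show ?thesis
    using assms(2) by (simp add: in_H)
qed

text \<open>
  A function of the hyperbolic distance \<open>d\<close>, namely \<open>2 * (cosh d - 1)\<close>. It is
  used in place of \<open>d\<close>: invariance and symmetry suffice for the covering argument, and both
  are visible from the formula.
\<close>
definition hyp_form :: "complex \<Rightarrow> complex \<Rightarrow> real" where
  "hyp_form z w = (cmod (z - w))\<^sup>2 / (Im z * Im w)"

lemma hyp_form_commute: "hyp_form z w = hyp_form w z"
  by (simp add: hyp_form_def norm_minus_commute mult.commute)

lemma hyp_form_invariant: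
  assumes "real_moebius f" "z \<in> upper_half_plane" "w \<in> upper_half_plane"
  shows "hyp_form (f z) (f w) = hyp_form z w"
proof -
  obtain a b c d :: real where m: "a * d - b * c = 1"
    "\<forall>z\<in>upper_half_plane. f z = (of_real a * z + of_real b) / (of_real c * z + of_real d)"
    using assms(1) unfolding real_moebius_def by blast
  define p where "p = cmod (of_real c * z + of_real d)"
  define q where "q = cmod (of_real c * w + of_real d)"
  have pq: "p \<noteq> 0" "q \<noteq> 0"
    using moebius_denom_nonzero[OF m(1)] assms(2,3) by (auto simp: p_def q_def)
  have "cmod (f z - f w) = cmod (z - w) / (p * q)"
    using m assms by (simp add: moebius_diff p_def q_def norm_divide norm_mult)
  moreover have "Im (f z) = Im z / p\<^sup>2" "Im (f w) = Im w / q\<^sup>2"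
    using m assms by (simp_all add: moebius_Im p_def q_def)
  ultimately show ?thesis
    using pq by (simp add: hyp_form_def power_divide power_mult_distrib)
qed

lemma real_moebius_inverse:
  assumes "real_moebius f"
  obtains g where "real_moebius g"
    "\<And>z. z \<in> upper_half_plane \<Longrightarrow> g (f z) = z" "\<And>z. z \<in> upper_half_plane \<Longrightarrow> f (g z) = z"
proof -
  obtain a b c d :: real where m: "a * d - b * c = 1"
    "\<forall>z\<in>upper_half_plane. f z = (of_real a * z + of_real b) / (of_real c * z + of_real d)"
    using assms(1) unfolding real_moebius_def by blast
  define g :: "complex \<Rightarrow> complex"
    where "g z = (of_real d * z + of_real (- b)) / (of_real (- c) * z + of_real a)" for z
  have m': "d * a - (- b) * (- c) = 1" using m(1) by (simp add: algebra_simps)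
  have g: "real_moebius g"
    unfolding real_moebius_def g_def using m' by blast
  have det: "of_real a * of_real d - of_real b * of_real c = (1::complex)"
    using m(1) by (metis of_real_1 of_real_diff of_real_mult)
  have gf: "g (f z) = z" if z: "z \<in> upper_half_plane" for z
  proof -
    define w where "w = f z"
    have w: "w \<in> upper_half_plane" unfolding w_def using real_moebius_in_H[OF assms z] .
    have "w * (of_real c * z + of_real d) = of_real a * z + of_real b"
      using m(2) z moebius_denom_nonzero[OF m(1) z] unfolding w_def by simp
    then have "of_real d * w + of_real (- b) = z * (of_real (- c) * w + of_real a)"
      by (simp add: algebra_simps)
    then have "g w = z"
      unfolding g_def using moebius_denom_nonzero[OF m' w] by simp
    then show ?thesis by (simp add: w_def)
  qed
  have fg: "f (g z) = z" if z: "z \<in> upper_half_plane" for z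
  proof -
    define w where "w = g z"
    have w: "w \<in> upper_half_plane" unfolding w_def using real_moebius_in_H[OF g z] .
    have "w * (of_real (- c) * z + of_real a) = of_real d * z + of_real (- b)"
      using moebius_denom_nonzero[OF m' z] unfolding w_def g_def by simp
    then have "of_real a * w + of_real b = z * (of_real c * w + of_real d)"
      by (simp add: algebra_simps)
    then have "f w = z"
      using m(2) w moebius_denom_nonzero[OF m(1) w] by simp
    then show ?thesis by (simp add: w_def)
  qed
  show thesis using that[OF g gf fg] .
qed

lemma real_moebius_bij:
  assumes "real_moebius f"
  shows "bij_betw f upper_half_plane upper_half_plane"
proof -
  obtain g where g: "real_moebius g" "\<And>z. z \<in> upper_half_plane \<Longrightarrow> g (f z) = z"
    "\<And>z. z \<in> upper_half_plane \<Longrightarrow> f (g z) = z"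
    using real_moebius_inverse[OF assms] by blast
  show ?thesis
    by (rule bij_betw_byWitness[of _ g])
       (use g real_moebius_in_H[OF assms] real_moebius_in_H[OF g(1)] in auto)
qed

lemma real_moebius_inv_into:
  assumes "real_moebius f"
  shows "real_moebius (inv_into upper_half_plane f)"
proof -
  obtain g where g: "real_moebius g" "\<And>z. z \<in> upper_half_plane \<Longrightarrow> g (f z) = z"
    "\<And>z. z \<in> upper_half_plane \<Longrightarrow> f (g z) = z"
    using real_moebius_inverse[OF assms] by blast
  have "inv_into upper_half_plane f z = g z" if "z \<in> upper_half_plane" for z
    using g(3)[OF that] real_moebius_in_H[OF g(1) that] real_moebius_bij[OF assms]
    by (auto intro!: inv_into_f_eq simp: bij_betw_def)
  then show ?thesis using g(1) unfolding real_moebius_def by simp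
qed

lemma real_moebius_continuous:
  assumes "real_moebius f"
  shows "continuous_on upper_half_plane f"
proof -
  obtain a b c d :: real where m: "a * d - b * c = 1"
    "\<forall>z\<in>upper_half_plane. f z = (of_real a * z + of_real b) / (of_real c * z + of_real d)"
    using assms(1) unfolding real_moebius_def by blast
  have "continuous_on upper_half_plane (\<lambda>z. (of_real a * z + of_real b) / (of_real c * z + of_real d))"
    using moebius_denom_nonzero[OF m(1)] by (intro continuous_intros) auto
  then show ?thesis using m(2) by (simp cong: continuous_on_cong)
qed

lemma less_iff_squares_less:
  fixes x y :: real
  assumes "0 \<le> x" "0 \<le> y"
  shows "x < y \<longleftrightarrow> x\<^sup>2 < y\<^sup>2"
  using assms by (meson power2_less_imp_less power_strict_mono zero_less_numeral)

lemma cmod_affine_squared: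
  "(cmod (of_real p * z + of_real q))\<^sup>2 = p\<^sup>2 * (cmod z)\<^sup>2 + 2 * p * q * Re z + q\<^sup>2"
  unfolding cmod_power2 by (simp add: power2_eq_square algebra_simps)

text \<open>
  The preimage of a half-disc is again a hyperbolic half-plane, and every hyperbolic half-plane is
  cut out by an inequality that is linear in \<open>Re z\<close> and the square of \<open>cmod z\<close>.
\<close>
lemma real_moebius_half_disc_linear:
  assumes "real_moebius f" "r > 0"
  obtains \<alpha> \<beta> \<gamma> :: real where "\<And>z. z \<in> upper_half_plane \<Longrightarrow>
    f z \<in> half_disc x r \<longleftrightarrow> \<alpha> * (cmod z)\<^sup>2 + \<beta> * Re z + \<gamma> < 0"
proof -
  obtain a b c d :: real where m: "a * d - b * c = 1"
    "\<forall>z\<in>upper_half_plane. f z = (of_real a * z + of_real b) / (of_real c * z + of_real d)"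
    using assms(1) unfolding real_moebius_def by blast
  define p where "p = a - x * c"
  define q where "q = b - x * d"
  have "f z \<in> half_disc x r \<longleftrightarrow>
     (p\<^sup>2 - r\<^sup>2 * c\<^sup>2) * (cmod z)\<^sup>2 + (2 * p * q - 2 * r\<^sup>2 * c * d) * Re z + (q\<^sup>2 - r\<^sup>2 * d\<^sup>2) < 0"
    if z: "z \<in> upper_half_plane" for z
  proof -
    have nz: "of_real c * z + of_real d \<noteq> 0" using moebius_denom_nonzero[OF m(1) z] .
    have "f z - of_real x = (of_real p * z + of_real q) / (of_real c * z + of_real d)"
      using m(2) z nz by (simp add: field_simps p_def q_def)
    then have "cmod (f z - of_real x)
        = cmod (of_real p * z + of_real q) / cmod (of_real c * z + of_real d)"
      by (simp only: norm_divide)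
    moreover have "cmod (of_real c * z + of_real d) > 0" using nz by simp
    ultimately have "cmod (f z - of_real x) < r \<longleftrightarrow>
        cmod (of_real p * z + of_real q) < r * cmod (of_real c * z + of_real d)"
      by (simp only: pos_divide_less_eq)
    also have "\<dots> \<longleftrightarrow> (cmod (of_real p * z + of_real q))\<^sup>2 < (r * cmod (of_real c * z + of_real d))\<^sup>2"
      using assms(2) by (intro less_iff_squares_less) auto
    finally have "cmod (f z - of_real x) < r \<longleftrightarrow>
      (p\<^sup>2 - r\<^sup>2 * c\<^sup>2) * (cmod z)\<^sup>2 + (2 * p * q - 2 * r\<^sup>2 * c * d) * Re z + (q\<^sup>2 - r\<^sup>2 * d\<^sup>2) < 0"
      unfolding power_mult_distrib cmod_affine_squared by (simp add: algebra_simps)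
    then show ?thesis
      using real_moebius_in_H[OF assms(1) z] by (simp add: in_half_disc in_H)
  qed
  then show thesis using that by blast
qed

lemma cmod_diff_real_squared: "(cmod (z - of_real c))\<^sup>2 = (cmod z)\<^sup>2 - 2 * c * Re z + c\<^sup>2"
  unfolding cmod_power2 by (simp add: power2_eq_square algebra_simps)

lemma half_disc_linear:
  assumes "r > 0" "z \<in> upper_half_plane"
  shows "z \<in> half_disc c r \<longleftrightarrow> 1 * (cmod z)\<^sup>2 + (- 2 * c) * Re z + (c\<^sup>2 - r\<^sup>2) < 0"
proof -
  have "cmod (z - of_real c) < r \<longleftrightarrow> (cmod (z - of_real c))\<^sup>2 < r\<^sup>2"
    using assms(1) by (intro less_iff_squares_less) auto
  then show ?thesis
    using assms(2) unfolding in_half_disc cmod_diff_real_squared in_H by auto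
qed

lemma half_disc_exterior_linear:
  assumes "r > 0" "z \<in> upper_half_plane"
  shows "z \<in> half_disc_exterior c r \<longleftrightarrow> (- 1) * (cmod z)\<^sup>2 + 2 * c * Re z + (r\<^sup>2 - c\<^sup>2) < 0"
proof -
  have "r < cmod (z - of_real c) \<longleftrightarrow> r\<^sup>2 < (cmod (z - of_real c))\<^sup>2"
    using assms(1) by (intro less_iff_squares_less) auto
  then show ?thesis
    using assms(2) unfolding in_half_disc_exterior cmod_diff_real_squared in_H by auto
qed

section \<open>Contractible regions in the Klein model\<close>

text \<open>
  Coordinates of the Klein model: the half-plane becomes the region above a parabola, and
  geodesics become straight lines, since on the circle with real centre \<open>c\<close> and radius
  \<open>r\<close> the second coordinate equals \<open>2 * c * Re z + r\<^sup>2 - c\<^sup>2\<close>.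
\<close>
definition klein :: "complex \<Rightarrow> real \<times> real" where
  "klein z = (Re z, (cmod z)\<^sup>2)"

lemma convex_combination_neg:
  fixes u v p q :: real
  assumes "u \<ge> 0" "v \<ge> 0" "u + v = 1" "p < 0" "q < 0"
  shows "u * p + v * q < 0"
proof (cases "u = 0")
  case True
  then show ?thesis using assms by simp
next
  case False
  then have "u * p < 0" using assms by (intro mult_pos_neg) auto
  moreover have "v * q \<le> 0" using assms by (intro mult_nonneg_nonpos) auto
  ultimately show ?thesis by simp
qed

text \<open>
  In Klein coordinates the region is an intersection of half-planes with the convex region above the
  parabola.
\<close>
lemma contractible_linear_region:
  fixes \<alpha> \<beta> \<gamma> :: "'i \<Rightarrow> real" and I :: "'i set"
  defines "Y \<equiv> {z \<in> upper_half_plane. \<forall>i\<in>I. \<alpha> i * (cmod z)\<^sup>2 + \<beta> i * Re z + \<gamma> i < 0}"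
  shows "contractible Y"
proof -
  define K where "K = {p :: real \<times> real. (fst p)\<^sup>2 < snd p \<and>
    (\<forall>i\<in>I. \<alpha> i * snd p + \<beta> i * fst p + \<gamma> i < 0)}"
  define g where "g p = Complex (fst p) (sqrt (snd p - (fst p)\<^sup>2))" for p :: "real \<times> real"
  have norm_g: "(cmod (g p))\<^sup>2 = snd p" if "(fst p)\<^sup>2 < snd p" for p
    using that by (simp add: g_def cmod_power2)
  have "homeomorphism Y K klein g"
    unfolding homeomorphism_def
  proof (intro conjI ballI)
    show kg: "klein (g p) = p" if "p \<in> K" for p
      using that norm_g[of p] by (auto simp: klein_def K_def prod_eq_iff) (simp add: g_def)
    show gk: "g (klein z) = z" if "z \<in> Y" for z
      using that by (auto simp: Y_def in_H klein_def g_def cmod_power2 complex_eq_iff)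
    have kY: "klein z \<in> K" if "z \<in> Y" for z
      using that by (auto simp: Y_def K_def klein_def in_H cmod_power2)
    have gK: "g p \<in> Y" if "p \<in> K" for p
      using that norm_g[of p] by (auto simp: Y_def K_def in_H) (auto simp: g_def)
    show "klein ` Y = K"
      using kY image_eqI[of _ klein, OF kg[symmetric] gK] by (intro equalityI subsetI) auto
    show "g ` K = Y"
      using gK image_eqI[of _ g, OF gk[symmetric] kY] by (intro equalityI subsetI) auto
    show "continuous_on Y klein" unfolding klein_def by (intro continuous_intros)
    show "continuous_on K g"
      unfolding g_def Complex_eq by (intro continuous_intros)
  qed
  moreover have "convex K"
  proof (rule convexI)
    fix p q :: "real \<times> real" and u v :: real
    assume pq: "p \<in> K" "q \<in> K" and uv: "0 \<le> u" "0 \<le> v" "u + v = 1"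
    let ?m = "u *\<^sub>R p + v *\<^sub>R q"
    have v: "v = 1 - u" using uv by simp
    have "(fst ?m)\<^sup>2 - snd ?m
        = u * ((fst p)\<^sup>2 - snd p) + v * ((fst q)\<^sup>2 - snd q) - u * v * (fst p - fst q)\<^sup>2"
      by (simp add: v power2_eq_square algebra_simps)
    moreover have "u * ((fst p)\<^sup>2 - snd p) + v * ((fst q)\<^sup>2 - snd q) < 0"
      using pq uv by (intro convex_combination_neg) (auto simp: K_def)
    moreover have "u * v * (fst p - fst q)\<^sup>2 \<ge> 0" using uv by simp
    ultimately have "(fst ?m)\<^sup>2 < snd ?m" by linarith
    moreover have "\<alpha> i * snd ?m + \<beta> i * fst ?m + \<gamma> i < 0" if "i \<in> I" for i
    proof -
      have "\<alpha> i * snd ?m + \<beta> i * fst ?m + \<gamma> i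
         = u * (\<alpha> i * snd p + \<beta> i * fst p + \<gamma> i) + v * (\<alpha> i * snd q + \<beta> i * fst q + \<gamma> i)"
        by (simp add: v algebra_simps)
      also have "\<dots> < 0"
        using pq uv that by (intro convex_combination_neg) (auto simp: K_def)
      finally show ?thesis .
    qed
    ultimately show "?m \<in> K" by (simp add: K_def)
  qed
  ultimately show ?thesis
    using convex_imp_contractible homeomorphic_contractible[of K Y] homeomorphic_sym[of Y K]
    unfolding homeomorphic_def by blast
qed

lemma finite_positive_lower_bound:
  fixes f :: "'i \<Rightarrow> real"
  assumes "finite I" "\<And>i. i \<in> I \<Longrightarrow> f i > 0"
  obtains e where "e > 0" "\<And>i. i \<in> I \<Longrightarrow> e < f i"
proof -
  have "\<exists>e>0. \<forall>i\<in>I. e < f i"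
    using assms
  proof (induction I rule: finite_induct)
    case empty
    show ?case by (intro exI[of _ 1]) auto
  next
    case (insert i I)
    then obtain e where "e > 0" "\<forall>j\<in>I. e < f j" by auto
    then show ?case
      using insert.prems[of i] by (intro exI[of _ "min e (f i / 2)"]) auto
  qed
  then show thesis using that by blast
qed

text \<open>
  If the intervals cut out on the real line overlapped, their weighted midpoint, moved slightly
  upwards, would lie in both half-discs.
\<close>
lemma half_disc_disjoint_gap:
  assumes "r > 0" "s > 0" "half_disc c r \<inter> half_disc d s = {}" "\<bar>c - d\<bar> \<noteq> r + s"
  shows "\<bar>c - d\<bar> > r + s"
proof (rule ccontr)
  assume "\<not> \<bar>c - d\<bar> > r + s"
  then have lt: "\<bar>c - d\<bar> < r + s" using assms(4) by simp
  \<comment> \<open>This point divides the segment from \<open>c\<close> to \<open>d\<close> in the ratio of the radii.\<close>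
  define x where "x = (s * c + r * d) / (r + s)"
  have rs: "r + s > 0" using assms by simp
  have "x - c = r * (d - c) / (r + s)" "x - d = s * (c - d) / (r + s)"
    using rs by (simp_all add: x_def field_simps)
  then have "\<bar>x - c\<bar> = r * (\<bar>c - d\<bar> / (r + s))" "\<bar>x - d\<bar> = s * (\<bar>c - d\<bar> / (r + s))"
    using assms rs by (simp_all add: abs_mult abs_minus_commute)
  moreover have "\<bar>c - d\<bar> / (r + s) < 1" using lt rs by simp
  ultimately have xcd: "\<bar>x - c\<bar> < r" "\<bar>x - d\<bar> < s"
    using assms(1,2) mult_strict_left_mono[of "\<bar>c - d\<bar> / (r + s)" 1] by auto
  define y where "y = min (r - \<bar>x - c\<bar>) (s - \<bar>x - d\<bar>) / 2"
  have y: "y > 0" "\<bar>x - c\<bar> + y < r" "\<bar>x - d\<bar> + y < s" using xcd by (auto simp: y_def min_def field_simps)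
  have "cmod (Complex x y - of_real e) \<le> \<bar>x - e\<bar> + y" for e
    using cmod_le[of "Complex x y - of_real e"] y(1) by simp
  then have "Complex x y \<in> half_disc c r \<inter> half_disc d s"
    using y by (auto simp: in_half_disc intro: le_less_trans)
  with assms(3) show False by simp
qed

section \<open>Side pairings of the Schottky polygon\<close>

text \<open>
  The letters \<open>1, \<dots>, 2n\<close> name the generators and their inverses uniformly:
  the map \<open>\<sigma> t\<close> sends the exterior of disc \<open>t\<close> into disc
  \<open>opp t\<close>, and \<open>\<sigma> (opp t)\<close> is its inverse.
\<close>
locale schottky =
  fixes n :: nat and c r :: "nat \<Rightarrow> real" and S :: "nat \<Rightarrow> complex \<Rightarrow> complex"
  assumes data: "schottky_data n c r S" and n_pos: "n \<ge> 1"
begin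

abbreviation "\<H> \<equiv> upper_half_plane"

definition letters :: "nat set" where "letters = {1..2 * n}"

definition opp :: "nat \<Rightarrow> nat" where "opp t = (if t \<le> n then t + n else t - n)"

definition \<sigma> :: "nat \<Rightarrow> complex \<Rightarrow> complex" where
  "\<sigma> t = (if t \<le> n then S t else inv_into \<H> (S (t - n)))"

abbreviation "D t \<equiv> half_disc (c t) (r t)"
abbreviation "B t \<equiv> half_disc_boundary (c t) (r t)"
abbreviation "E t \<equiv> half_disc_exterior (c t) (r t)"

lemma finite_letters [simp]: "finite letters" by (simp add: letters_def)

lemma opp_letters [simp]: "t \<in> letters \<Longrightarrow> opp t \<in> letters"
  by (auto simp: letters_def opp_def)

lemma opp_opp [simp]: "t \<in> letters \<Longrightarrow> opp (opp t) = t"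
  by (auto simp: letters_def opp_def)

lemma generator_letter: "j \<in> {1..n} \<Longrightarrow> j \<in> letters \<and> opp j = j + n \<and> \<sigma> j = S j"
  by (auto simp: letters_def opp_def \<sigma>_def)

lemma letter_cases:
  assumes "t \<in> letters"
  obtains "t \<in> {1..n}" | j where "j \<in> {1..n}" "t = opp j"
proof (cases "t \<le> n")
  case True
  then show thesis using assms that(1) by (auto simp: letters_def)
next
  case False
  then have "t - n \<in> {1..n}" "t = opp (t - n)"
    using assms by (auto simp: letters_def opp_def)
  then show thesis using that(2) by blast
qed

lemma r_pos: "t \<in> letters \<Longrightarrow> r t > 0"
  using data by (simp add: schottky_data_def letters_def)

lemma gap: "s \<in> letters \<Longrightarrow> t \<in> letters \<Longrightarrow> s \<noteq> t \<Longrightarrow> \<bar>c s - c t\<bar> > r s + r t"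
  using data half_disc_disjoint_gap[of "r s" "r t" "c s" "c t"] r_pos[of s] r_pos[of t]
  by (simp add: schottky_data_def letters_def)

lemma real_moebius_S: "j \<in> {1..n} \<Longrightarrow> real_moebius (S j)"
  using data PSL2R_real_moebius by (simp add: schottky_data_def)

lemma H_cases:
  assumes "z \<in> \<H>"
  obtains "z \<in> D t" | "z \<in> B t" | "z \<in> E t"
  using assms by (auto simp: in_half_disc in_half_disc_boundary in_half_disc_exterior in_H
      intro: linorder_cases[of "cmod (z - of_real (c t))" "r t"])

lemma DBE_subset_H: "z \<in> D t \<or> z \<in> B t \<or> z \<in> E t \<Longrightarrow> z \<in> \<H>"
  by (auto simp: in_half_disc in_half_disc_boundary in_half_disc_exterior in_H)

lemma DBE_disjoint:
  "z \<in> E t \<Longrightarrow> z \<notin> D t" "z \<in> E t \<Longrightarrow> z \<notin> B t" "z \<in> B t \<Longrightarrow> z \<notin> D t"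
  by (auto simp: in_half_disc in_half_disc_boundary in_half_disc_exterior)

lemma real_moebius_\<sigma>: "t \<in> letters \<Longrightarrow> real_moebius (\<sigma> t)"
  by (auto simp: \<sigma>_def letters_def intro!: real_moebius_S real_moebius_inv_into)

lemma \<sigma>_in_H: "t \<in> letters \<Longrightarrow> z \<in> \<H> \<Longrightarrow> \<sigma> t z \<in> \<H>"
  using real_moebius_in_H real_moebius_\<sigma> by blast

lemma \<sigma>_opp:
  assumes "t \<in> letters" "z \<in> \<H>"
  shows "\<sigma> (opp t) (\<sigma> t z) = z"
proof (rule letter_cases[OF assms(1)])
  assume t: "t \<in> {1..n}"
  then have "\<sigma> (opp t) = inv_into \<H> (S t)" by (auto simp: \<sigma>_def opp_def)
  then show ?thesis
    using real_moebius_bij[OF real_moebius_S[OF t]] generator_letter[OF t] assms(2)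
    by (simp add: bij_betw_def)
next
  fix j assume j: "j \<in> {1..n}" "t = opp j"
  then have "\<sigma> t = inv_into \<H> (S j)" "\<sigma> (opp t) = S j"
    by (auto simp: \<sigma>_def opp_def)
  then show ?thesis
    using real_moebius_bij[OF real_moebius_S[OF j(1)]] assms(2)
    by (simp add: bij_betw_def f_inv_into_f)
qed

lemma S_images:
  assumes "j \<in> {1..n}"
  shows "S j ` B j = B (j + n)" "S j ` E j = D (j + n)"
  using data assms by (auto simp: schottky_data_def)

text \<open>
  A generator is a bijection of the half-plane and already uses up the closed disc
  \<open>j + n\<close> on the boundary and exterior of disc \<open>j\<close>.
\<close>
lemma S_D:
  assumes j: "j \<in> {1..n}" and z: "z \<in> D j"
  shows "S j z \<in> E (j + n)"
proof -
  note inj = bij_betw_imp_inj_on[OF real_moebius_bij[OF real_moebius_S[OF j]]]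
  have zH: "z \<in> \<H>" using z DBE_subset_H by blast
  have "S j z \<notin> B (j + n)"
  proof
    assume "S j z \<in> B (j + n)"
    then obtain w where w: "w \<in> B j" "S j z = S j w" unfolding S_images(1)[OF j, symmetric] by blast
    then have "z = w" using inj_onD[OF inj w(2) zH] DBE_subset_H by blast
    with w(1) z show False using DBE_disjoint by blast
  qed
  moreover have "S j z \<notin> D (j + n)"
  proof
    assume "S j z \<in> D (j + n)"
    then obtain w where w: "w \<in> E j" "S j z = S j w" unfolding S_images(2)[OF j, symmetric] by blast
    then have "z = w" using inj_onD[OF inj w(2) zH] DBE_subset_H by blast
    with w(1) z show False using DBE_disjoint by blast
  qed
  ultimately show ?thesis
    using H_cases[OF real_moebius_in_H[OF real_moebius_S[OF j] zH], of "j + n"] by blast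
qed

lemma \<sigma>_maps:
  assumes t: "t \<in> letters"
  shows "z \<in> E t \<Longrightarrow> \<sigma> t z \<in> D (opp t)"
    and "z \<in> B t \<Longrightarrow> \<sigma> t z \<in> B (opp t)"
    and "z \<in> D t \<Longrightarrow> \<sigma> t z \<in> E (opp t)"
proof -
  have *: "(z \<in> E t \<longrightarrow> \<sigma> t z \<in> D (opp t)) \<and> (z \<in> B t \<longrightarrow> \<sigma> t z \<in> B (opp t)) \<and>
    (z \<in> D t \<longrightarrow> \<sigma> t z \<in> E (opp t))" if z: "z \<in> \<H>" for z
  proof (rule letter_cases[OF t])
    assume j: "t \<in> {1..n}"
    have g: "opp t = t + n" "\<sigma> t = S t" using generator_letter[OF j] by auto
    have "S t z \<in> D (t + n)" if "z \<in> E t" using S_images(2)[OF j] that by blast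
    moreover have "S t z \<in> B (t + n)" if "z \<in> B t" using S_images(1)[OF j] that by blast
    moreover have "S t z \<in> E (t + n)" if "z \<in> D t" using S_D[OF j that] .
    ultimately show ?thesis unfolding g by blast
  next
    fix j assume j: "j \<in> {1..n}" "t = opp j"
    have g: "opp j = j + n" "\<sigma> j = S j" "j \<in> letters" using generator_letter[OF j(1)] by auto
    let ?w = "\<sigma> t z"
    have w: "?w \<in> \<H>" using \<sigma>_in_H[OF t z] .
    have Sw: "S j ?w = z"
      using \<sigma>_opp[OF t z] unfolding j(2) opp_opp[OF g(3)] g(2) .
    have tj: "opp t = j" "t = j + n" using j(2) g(1) opp_opp[OF g(3)] by simp_all
    consider "?w \<in> D j" | "?w \<in> B j" | "?w \<in> E j" using H_cases[OF w] by blast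
    then show ?thesis
    proof cases
      case 1
      then have "z \<in> E t" using S_D[OF j(1) 1] Sw tj by simp
      then show ?thesis using 1 DBE_disjoint unfolding tj(1) by blast
    next
      case 2
      then have "z \<in> B t" using S_images(1)[OF j(1)] Sw tj by (metis imageI)
      then show ?thesis using 2 DBE_disjoint unfolding tj(1) by blast
    next
      case 3
      then have "z \<in> D t" using S_images(2)[OF j(1)] Sw tj by (metis imageI)
      then show ?thesis using 3 DBE_disjoint unfolding tj(1) by blast
    qed
  qed
  show "z \<in> E t \<Longrightarrow> \<sigma> t z \<in> D (opp t)" "z \<in> B t \<Longrightarrow> \<sigma> t z \<in> B (opp t)"
    "z \<in> D t \<Longrightarrow> \<sigma> t z \<in> E (opp t)"
    using *[of z] DBE_subset_H by blast+
qed

lemma near_disc_far_from_others: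
  assumes "cmod (z - of_real (c t)) \<le> \<rho>" "\<bar>c s - c t\<bar> > \<rho>' + \<rho>"
  shows "cmod (z - of_real (c s)) > \<rho>'"
proof -
  have "\<bar>c s - c t\<bar> = cmod ((z - of_real (c t)) - (z - of_real (c s)))"
    by (simp flip: of_real_diff add: norm_of_real)
  also have "\<dots> \<le> cmod (z - of_real (c t)) + cmod (z - of_real (c s))"
    by (rule norm_triangle_ineq4)
  finally show ?thesis using assms by linarith
qed

lemma closed_disc_in_other_exterior:
  assumes "s \<in> letters" "t \<in> letters" "s \<noteq> t" "z \<in> D t \<or> z \<in> B t"
  shows "z \<in> E s"
  using near_disc_far_from_others[where z = z and t = t and \<rho> = "r t" and s = s and \<rho>' = "r s"]
    gap[OF assms(1-3)] assms(4)
  by (auto simp: in_half_disc in_half_disc_boundary in_half_disc_exterior)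

text \<open>
  The closed polygon \<open>F\<close> is the fundamental domain of the group and \<open>F_int\<close>
  its interior; they differ by the boundary arcs.
\<close>
definition F :: "complex set" where "F = {z \<in> \<H>. \<forall>t\<in>letters. z \<notin> D t}"

definition F_int :: "complex set" where "F_int = {z \<in> \<H>. \<forall>t\<in>letters. z \<in> E t}"

lemma F_int_subset_F: "F_int \<subseteq> F"
  using DBE_disjoint by (auto simp: F_int_def F_def)

lemma B_subset_F:
  assumes "t \<in> letters" "z \<in> B t"
  shows "z \<in> F"
proof -
  have "z \<notin> D s" if "s \<in> letters" for s
  proof (cases "s = t")
    case True
    then show ?thesis using assms DBE_disjoint by blast
  next
    case False
    then have "z \<in> E s" using closed_disc_in_other_exterior that assms by blast
    then show ?thesis using DBE_disjoint by blast
  qed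
  then show ?thesis using assms DBE_subset_H by (auto simp: F_def)
qed

lemma B_not_F_int: "t \<in> letters \<Longrightarrow> z \<in> B t \<Longrightarrow> z \<notin> F_int"
  unfolding F_int_def using DBE_disjoint(2) by blast

lemma F_cases:
  assumes "z \<in> F"
  obtains "z \<in> F_int" | t where "t \<in> letters" "z \<in> B t"
proof (cases "z \<in> F_int")
  case False
  then obtain t where t: "t \<in> letters" "z \<notin> E t" using assms by (auto simp: F_int_def F_def)
  then have "z \<in> B t" using assms H_cases[of z t] by (auto simp: F_def)
  with t that(2) show thesis by blast
qed (rule that(1))

section \<open>Reduced paths and ping-pong\<close>

text \<open>
  Lying in the same orbit, generated by single letters. Induction on this relation replaces the
  handling of words in the generators.
\<close>
inductive reach :: "complex \<Rightarrow> complex \<Rightarrow> bool" where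
  refl [intro]: "reach z z"
| step: "reach z w \<Longrightarrow> t \<in> letters \<Longrightarrow> reach z (\<sigma> t w)"

text \<open>
  Paths that never undo their previous letter; the index is the last letter applied.
\<close>
inductive reduced :: "complex \<Rightarrow> nat \<Rightarrow> complex \<Rightarrow> bool" where
  start: "t \<in> letters \<Longrightarrow> reduced z t (\<sigma> t z)"
| extend: "reduced z s w \<Longrightarrow> t \<in> letters \<Longrightarrow> t \<noteq> opp s \<Longrightarrow> reduced z t (\<sigma> t w)"

lemma reach_in_H: "reach z w \<Longrightarrow> z \<in> \<H> \<Longrightarrow> w \<in> \<H>"
  by (induction rule: reach.induct) (auto simp: \<sigma>_in_H)

lemma reach_single: "t \<in> letters \<Longrightarrow> reach z (\<sigma> t z)"
  by (intro reach.step reach.refl)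

lemma reach_trans: "reach w v \<Longrightarrow> reach z w \<Longrightarrow> reach z v"
  by (induction rule: reach.induct) (auto intro: reach.step)

lemma reach_sym: "reach z w \<Longrightarrow> z \<in> \<H> \<Longrightarrow> reach w z"
proof (induction rule: reach.induct)
  case (step z w t)
  have "reach (\<sigma> t w) (\<sigma> (opp t) (\<sigma> t w))"
    using step by (intro reach_single) auto
  then have "reach (\<sigma> t w) w"
    using step \<sigma>_opp reach_in_H by simp
  then show ?case using step reach_trans by blast
qed auto

lemma reduced_letter: "reduced z t w \<Longrightarrow> t \<in> letters"
  by (induction rule: reduced.induct) auto

text \<open>
  A letter that undoes the previous one cancels it, and the path without its last letter is reduced.
\<close>
lemma reach_imp_reduced:
  assumes "reach z w" "z \<in> \<H>"
  shows "w = z \<or> (\<exists>t. reduced z t w)"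
  using assms
proof (induction rule: reach.induct)
  case (step z w t)
  from step.IH[OF step.prems] show ?case
  proof (elim disjE exE)
    assume "w = z"
    then show ?thesis using step.hyps reduced.start by blast
  next
    fix s assume red: "reduced z s w"
    show ?thesis
    proof (cases "t = opp s")
      case False
      then show ?thesis using red step.hyps reduced.extend by blast
    next
      case True
      from red show ?thesis
      proof cases
        case start
        then have "\<sigma> t w = z" using True \<sigma>_opp step.prems by simp
        then show ?thesis by simp
      next
        case (extend s' w')
        have w': "w' \<in> \<H>"
          using extend(2) step.prems
        proof (induction rule: reduced.induct)
        qed (auto simp: \<sigma>_in_H)
        then have "\<sigma> t w = w'" using True extend \<sigma>_opp by simp
        then show ?thesis using extend by blast
      qed
    qed
  qed
qed auto

text \<open>
  The first letter moves a point of the polygon into the closed disc \<open>opp t\<close>. This disc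
  lies in the exterior of every disc other than itself, so a following letter that does not undo the first
  sends the point into an open disc, and from then on every point of the path is in an open disc.
\<close>
lemma reduced_ping_pong:
  assumes "reduced z t w" "z \<in> F"
  shows "w \<in> D (opp t) \<or> (w \<in> B (opp t) \<and> w = \<sigma> t z \<and> z \<in> B t)"
  using assms
proof (induction rule: reduced.induct)
  case (start t z)
  then have z: "z \<in> \<H>" "z \<notin> D t" by (auto simp: F_def)
  then show ?case
    using H_cases[OF z(1), of t] \<sigma>_maps(1,2)[OF start(1), of z] by blast
next
  case (extend z s w t)
  have s: "s \<in> letters" using reduced_letter[OF extend.hyps(1)] .
  have "w \<in> E t"
    using closed_disc_in_other_exterior[OF extend.hyps(2) opp_letters[OF s] extend.hyps(3)]
      extend.IH[OF extend.prems] by blast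
  then show ?case using \<sigma>_maps(1)[OF extend.hyps(2)] by blast
qed

text \<open>
  The only identifications inside the closed polygon are the side pairings.
\<close>
lemma ping_pong:
  assumes "reach z w" "z \<in> F" "w \<in> F"
  shows "w = z \<or> (\<exists>t\<in>letters. z \<in> B t \<and> w \<in> B (opp t) \<and> w = \<sigma> t z)"
proof -
  have "z \<in> \<H>" using assms by (simp add: F_def)
  then consider "w = z" | t where "reduced z t w" using reach_imp_reduced[OF assms(1)] by blast
  then show ?thesis
  proof cases
    case 2
    then have t: "t \<in> letters" by (rule reduced_letter)
    then have "w \<notin> D (opp t)" using assms(3) by (simp add: F_def)
    then show ?thesis using reduced_ping_pong[OF 2 assms(2)] t by blast
  qed simp
qed

section \<open>Orbits of the Schottky group\<close>

definition \<Gamma> :: "(complex \<Rightarrow> complex) set" where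
  "\<Gamma> = generate (BijGroup \<H>) (S ` {1..n})"

abbreviation "\<pi> \<equiv> group_orbit \<Gamma>"

lemma S_Bij: "j \<in> {1..n} \<Longrightarrow> S j \<in> Bij \<H>"
proof -
  assume j: "j \<in> {1..n}"
  have "S j \<in> PSL2R" using data j by (simp add: schottky_data_def)
  then have "S j \<in> extensional \<H>" by (auto simp: PSL2R_def moebius_def)
  then show ?thesis
    using real_moebius_bij[OF real_moebius_S[OF j]] by (simp add: Bij_def)
qed

lemma inv_S:
  assumes "j \<in> {1..n}"
  shows "inv\<^bsub>BijGroup \<H>\<^esub> (S j) = restrict (\<sigma> (opp j)) \<H>"
proof -
  have "\<sigma> (opp j) = inv_into \<H> (S j)" using assms by (auto simp: \<sigma>_def opp_def)
  then show ?thesis using inv_BijGroup[OF S_Bij[OF assms]] by simp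
qed

text \<open>
  Together with \<open>reach_\<Gamma>\<close> below this identifies orbits of the group with classes of
  \<^const>\<open>reach\<close>.
\<close>
lemma \<Gamma>_reach:
  assumes "g \<in> \<Gamma>"
  shows "g \<in> Bij \<H> \<and> (\<forall>z\<in>\<H>. reach z (g z))"
  using assms unfolding \<Gamma>_def
proof (induction rule: generate.induct)
  case one
  have "\<one>\<^bsub>BijGroup \<H>\<^esub> = (\<lambda>z\<in>\<H>. z)" by (simp add: BijGroup_def)
  then show ?case using id_Bij[of \<H>] by (metis reach.refl restrict_apply')
next
  case (incl h)
  then show ?case using S_Bij generator_letter reach_single by (metis imageE)
next
  case (inv h)
  then obtain j where j: "j \<in> {1..n}" "h = S j" by blast
  have "inv\<^bsub>BijGroup \<H>\<^esub> h \<in> Bij \<H>"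
    unfolding j(2) inv_BijGroup[OF S_Bij[OF j(1)]] by (rule restrict_inv_into_Bij[OF S_Bij[OF j(1)]])
  moreover have "reach z ((inv\<^bsub>BijGroup \<H>\<^esub> h) z)" if "z \<in> \<H>" for z
    using that reach_single[OF opp_letters, of j z] generator_letter[OF j(1)]
    unfolding j(2) inv_S[OF j(1)] by simp
  ultimately show ?case by blast
next
  case (eng g h)
  have "reach z (g (h z))" if "z \<in> \<H>" for z
  proof -
    have "reach z (h z)" "h z \<in> \<H>" using eng that reach_in_H by blast+
    then show ?thesis using eng reach_trans by blast
  qed
  then show ?case
    using eng by (auto simp: BijGroup_def compose_Bij compose_eq)
qed

lemma reach_\<Gamma>:
  assumes "reach z w" "z \<in> \<H>"
  shows "\<exists>g\<in>\<Gamma>. w = g z"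
  using assms
proof (induction rule: reach.induct)
  case (refl z)
  have "\<one>\<^bsub>BijGroup \<H>\<^esub> \<in> \<Gamma>" unfolding \<Gamma>_def by (rule generate.one)
  moreover have "\<one>\<^bsub>BijGroup \<H>\<^esub> z = z" using refl by (simp add: BijGroup_def)
  ultimately show ?case by metis
next
  case (step z w t)
  then obtain g where g: "g \<in> \<Gamma>" "w = g z" by blast
  have w: "w \<in> \<H>" using step reach_in_H by blast
  obtain h where h: "h \<in> \<Gamma>" "h w = \<sigma> t w"
  proof (rule letter_cases[OF step.hyps(2)])
    assume t: "t \<in> {1..n}"
    then have "S t \<in> \<Gamma>" unfolding \<Gamma>_def by (intro generate.incl imageI)
    then show thesis using that[of "S t"] generator_letter[OF t] by simp
  next
    fix j assume j: "j \<in> {1..n}" "t = opp j"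
    have "inv\<^bsub>BijGroup \<H>\<^esub> (S j) \<in> \<Gamma>" unfolding \<Gamma>_def using j by (intro generate.inv) auto
    moreover have "(inv\<^bsub>BijGroup \<H>\<^esub> (S j)) w = \<sigma> t w" using j w by (simp add: inv_S)
    ultimately show thesis using that by blast
  qed
  have "h \<otimes>\<^bsub>BijGroup \<H>\<^esub> g \<in> \<Gamma>"
    using g h unfolding \<Gamma>_def by (intro generate.eng)
  moreover have "(h \<otimes>\<^bsub>BijGroup \<H>\<^esub> g) z = \<sigma> t w"
    using g h \<Gamma>_reach step.prems by (simp add: BijGroup_def compose_eq)
  ultimately show ?case by metis
qed

lemma orbit_eq: "z \<in> \<H> \<Longrightarrow> \<pi> z = {w. reach z w}"
  using \<Gamma>_reach reach_\<Gamma>[of z] by (fastforce simp: group_orbit_def orbit_def)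

lemma \<pi>_eq_iff:
  assumes "z \<in> \<H>" "w \<in> \<H>"
  shows "\<pi> z = \<pi> w \<longleftrightarrow> reach z w"
proof
  assume "\<pi> z = \<pi> w"
  then show "reach z w" using assms reach.refl[of w] by (auto simp: orbit_eq)
next
  assume zw: "reach z w"
  then have "reach w z" using assms reach_sym by blast
  with zw show "\<pi> z = \<pi> w" using assms reach_trans by (auto simp: orbit_eq)
qed

end

context schottky
begin

section \<open>Translates of the polygon cover the half-plane\<close>

text \<open>
  The group element that moves \<open>z\<close> to \<open>w\<close>, as a function on the half-plane: it
  will also be applied to points near \<open>z\<close>.
\<close>
lemma reach_isometry:
  assumes "reach z w" "z \<in> \<H>"
  shows "\<exists>f. f z = w \<and> (\<forall>x\<in>\<H>. reach x (f x)) \<and>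
    (\<forall>x\<in>\<H>. \<forall>y\<in>\<H>. hyp_form (f x) (f y) = hyp_form x y)"
  using assms
proof (induction rule: reach.induct)
  case (refl z)
  show ?case by (intro exI[of _ "\<lambda>x. x"]) (auto intro: reach.refl)
next
  case (step z w t)
  then obtain f where f: "f z = w" "\<forall>x\<in>\<H>. reach x (f x)"
    "\<forall>x\<in>\<H>. \<forall>y\<in>\<H>. hyp_form (f x) (f y) = hyp_form x y"
    by blast
  have "hyp_form (\<sigma> t (f x)) (\<sigma> t (f y)) = hyp_form x y" if "x \<in> \<H>" "y \<in> \<H>" for x y
  proof -
    have "f x \<in> \<H>" "f y \<in> \<H>" using that f(2) reach_in_H by blast+
    then show ?thesis using f(3) that hyp_form_invariant[OF real_moebius_\<sigma>[OF step.hyps(2)]] by simp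
  qed
  then show ?case
    using f step.hyps(2) by (intro exI[of _ "\<lambda>x. \<sigma> t (f x)"]) (auto intro: reach.step)
qed

lemma hyp_form_disc_gap:
  assumes st: "s \<in> letters" "t \<in> letters" "s \<noteq> t"
    and z: "z \<in> \<H>" "cmod (z - of_real (c s)) \<le> r s"
    and w: "w \<in> \<H>" "cmod (w - of_real (c t)) \<le> r t"
  shows "hyp_form z w \<ge> (\<bar>c s - c t\<bar> - r s - r t)\<^sup>2 / (r s * r t)"
proof -
  have "\<bar>c s - c t\<bar> = cmod ((w - of_real (c t)) - (z - of_real (c s)) + (z - w))"
    by (simp flip: of_real_diff add: norm_of_real)
  also have "\<dots> \<le> cmod (w - of_real (c t)) + cmod (z - of_real (c s)) + cmod (z - w)"
    by (intro norm_triangle_le add_right_mono norm_triangle_ineq4)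
  finally have "\<bar>c s - c t\<bar> - r s - r t \<le> cmod (z - w)" using z w by linarith
  then have "(\<bar>c s - c t\<bar> - r s - r t)\<^sup>2 \<le> (cmod (z - w))\<^sup>2"
    using gap[OF st] by (intro power_mono) auto
  moreover have "Im z \<le> r s" "Im w \<le> r t"
    using abs_Im_le_cmod[of "z - of_real (c s)"] abs_Im_le_cmod[of "w - of_real (c t)"] z w by auto
  ultimately show ?thesis
    unfolding hyp_form_def using z(1) w(1) by (intro frac_le mult_mono) (auto simp: in_H)
qed

text \<open>
  A point \<open>w\<close> close to the polygon but inside disc \<open>t\<close> is moved by
  \<open>\<sigma> t\<close> outside disc \<open>opp t\<close>, while its neighbour
  \<open>z\<close> is moved into the closure of that disc. Distinct discs are a definite distance
  apart, so the image of \<open>w\<close> cannot lie in any third disc and has landed in the polygon.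
  Since the discs are finitely many, one \<open>\<epsilon>\<close> serves all of them.
\<close>
lemma uniform_neighbourhood:
  obtains \<epsilon> where "\<epsilon> > 0"
    "\<And>z w. z \<in> F \<Longrightarrow> w \<in> \<H> \<Longrightarrow> hyp_form z w < \<epsilon> \<Longrightarrow> \<exists>v\<in>F. reach w v"
proof -
  let ?P = "{p \<in> letters \<times> letters. fst p \<noteq> snd p}"
  let ?\<delta> = "\<lambda>p. (\<bar>c (fst p) - c (snd p)\<bar> - r (fst p) - r (snd p))\<^sup>2 / (r (fst p) * r (snd p))"
  have "?\<delta> p > 0" if "p \<in> ?P" for p
    using that gap[of "fst p" "snd p"] r_pos by (intro divide_pos_pos mult_pos_pos) auto
  then obtain \<epsilon> where \<epsilon>: "\<epsilon> > 0" "\<And>p. p \<in> ?P \<Longrightarrow> \<epsilon> < ?\<delta> p"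
    using finite_positive_lower_bound[of ?P ?\<delta>] by auto
  have "\<exists>v\<in>F. reach w v" if z: "z \<in> F" and w: "w \<in> \<H>" and zw: "hyp_form z w < \<epsilon>" for z w
  proof (cases "w \<in> F")
    case True
    then show ?thesis by blast
  next
    case False
    then obtain t where t: "t \<in> letters" "w \<in> D t" using w by (auto simp: F_def)
    have zH: "z \<in> \<H>" "z \<notin> D t" using z t by (auto simp: F_def)
    have ot: "opp t \<in> letters" using t by simp
    let ?z = "\<sigma> t z" and ?w = "\<sigma> t w"
    have w': "?w \<in> E (opp t)" using \<sigma>_maps(3)[OF t] .
    have z': "?z \<in> D (opp t) \<or> ?z \<in> B (opp t)"
      using H_cases[OF zH(1), of t] zH(2) \<sigma>_maps(1,2)[OF t(1), of z] by blast
    have "?w \<notin> D s" if s: "s \<in> letters" for s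
    proof
      assume ws: "?w \<in> D s"
      then have ne: "opp t \<noteq> s" using w' DBE_disjoint by blast
      have "\<epsilon> < ?\<delta> (opp t, s)" using ne s ot by (intro \<epsilon>) auto
      also have "\<dots> \<le> hyp_form ?z ?w"
        using hyp_form_disc_gap[OF ot s ne, of ?z ?w] z' ws
        by (auto simp: in_half_disc in_half_disc_boundary in_H)
      also have "\<dots> = hyp_form z w"
        using hyp_form_invariant[OF real_moebius_\<sigma>[OF t(1)] zH(1) w] .
      finally show False using zw by simp
    qed
    then have "?w \<in> F" using \<sigma>_in_H[OF t(1) w] by (simp add: F_def)
    then show ?thesis using reach_single[OF t(1)] by blast
  qed
  with \<epsilon>(1) show thesis using that by blast
qed

lemma F_nonempty: "F \<noteq> {}"
proof -
  have 1: "1 \<in> letters" using n_pos by (simp add: letters_def)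
  then have "Complex (c 1) (r 1) \<in> B 1"
    using r_pos[of 1] by (simp add: in_half_disc_boundary cmod_def)
  then show ?thesis using B_subset_F[OF 1] by blast
qed

text \<open>
  The set \<open>C\<close> of points equivalent to a point of the polygon contains with each point its
  whole \<open>\<epsilon>\<close>-neighbourhood, since the group acts by isometries. By symmetry of the
  distance so does the complement. Both sets are therefore open, and the half-plane is connected.
\<close>
theorem translates_cover:
  assumes "z \<in> \<H>"
  shows "\<exists>w\<in>F. reach z w"
proof -
  obtain \<epsilon> where \<epsilon>: "\<epsilon> > 0"
    "\<And>z w. z \<in> F \<Longrightarrow> w \<in> \<H> \<Longrightarrow> hyp_form z w < \<epsilon> \<Longrightarrow> \<exists>v\<in>F. reach w v"
    using uniform_neighbourhood by blast
  define C where "C = {z \<in> \<H>. \<exists>w\<in>F. reach z w}"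
  have near: "w \<in> C" if z: "z \<in> C" and w: "w \<in> \<H>" and zw: "hyp_form z w < \<epsilon>" for z w
  proof -
    obtain v where v: "v \<in> F" "reach z v" using z by (auto simp: C_def)
    have zH: "z \<in> \<H>" using z by (simp add: C_def)
    obtain f where f: "f z = v" "\<forall>x\<in>\<H>. reach x (f x)"
      "\<forall>x\<in>\<H>. \<forall>y\<in>\<H>. hyp_form (f x) (f y) = hyp_form x y"
      using reach_isometry[OF v(2) zH] by blast
    have "reach w (f w)" using f(2) w by blast
    moreover have "hyp_form v (f w) < \<epsilon>" using f(1,3) zH w zw by auto
    ultimately obtain u where "u \<in> F" "reach (f w) u" using \<epsilon>(2)[OF v(1)] reach_in_H w by blast
    then show ?thesis using \<open>reach w (f w)\<close> reach_trans w by (auto simp: C_def)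
  qed
  have ball: "open {w \<in> \<H>. hyp_form z w < \<epsilon>}" "z \<in> {w \<in> \<H>. hyp_form z w < \<epsilon>}" if "z \<in> \<H>" for z
  proof -
    have "continuous_on \<H> (hyp_form z)"
      unfolding hyp_form_def using that by (intro continuous_intros) (auto simp: in_H)
    then have "open (\<H> \<inter> hyp_form z -` {..<\<epsilon>})"
      by (intro continuous_open_preimage open_upper_half_plane) auto
    moreover have "\<H> \<inter> hyp_form z -` {..<\<epsilon>} = {w \<in> \<H>. hyp_form z w < \<epsilon>}" by auto
    ultimately show "open {w \<in> \<H>. hyp_form z w < \<epsilon>}" by simp
    show "z \<in> {w \<in> \<H>. hyp_form z w < \<epsilon>}" using that \<epsilon>(1) by (simp add: hyp_form_def)
  qed
  have "open C"
    unfolding open_subopen[of C]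
  proof
    fix z assume z: "z \<in> C"
    then have "z \<in> \<H>" by (simp add: C_def)
    then show "\<exists>T. open T \<and> z \<in> T \<and> T \<subseteq> C"
      using ball[of z] near[OF z] by (intro exI[of _ "{w \<in> \<H>. hyp_form z w < \<epsilon>}"]) auto
  qed
  moreover have "open (\<H> - C)"
    unfolding open_subopen[of "\<H> - C"]
  proof
    fix z assume z: "z \<in> \<H> - C"
    have "w \<notin> C" if "w \<in> \<H>" "hyp_form z w < \<epsilon>" for w
      using near[of w z] z that by (auto simp: hyp_form_commute)
    then show "\<exists>T. open T \<and> z \<in> T \<and> T \<subseteq> \<H> - C"
      using ball[of z] z by (intro exI[of _ "{w \<in> \<H>. hyp_form z w < \<epsilon>}"]) auto
  qed
  moreover have "C \<inter> \<H> \<noteq> {}" using F_nonempty by (auto simp: C_def F_def)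
  moreover have "connected \<H>" using convex_upper_half_plane by (rule convex_connected)
  ultimately have "(\<H> - C) \<inter> \<H> = {}"
    using connectedD[of \<H> C "\<H> - C"] by (auto simp: C_def)
  then show ?thesis using assms by (auto simp: C_def)
qed

section \<open>The orbit map\<close>

abbreviation "X \<equiv> quotient_surface \<Gamma>"

lemma topspace_X: "topspace X = \<pi> ` \<H>"
  using quotient_imp_surjective_map[OF quotient_map_quotient_surface[of \<Gamma>]] by simp

lemma \<pi>_continuous: "continuous_map (top_of_set \<H>) X \<pi>"
  by (rule quotient_imp_continuous_map[OF quotient_map_quotient_surface])

text \<open>
  The content of openness of the orbit map: the letters are homeomorphisms of the half-plane.
\<close>
lemma saturation_nbhd:
  assumes "reach z w" "z \<in> U" "open U" "U \<subseteq> \<H>"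
  shows "\<exists>V. open V \<and> w \<in> V \<and> V \<subseteq> \<H> \<and> (\<forall>v\<in>V. \<exists>u\<in>U. reach u v)"
  using assms(1,2)
proof (induction rule: reach.induct)
  case (refl z)
  then show ?case using assms(3,4) by (intro exI[of _ U]) (auto intro: reach.refl)
next
  case (step z w t)
  then obtain V where V: "open V" "w \<in> V" "V \<subseteq> \<H>" "\<forall>v\<in>V. \<exists>u\<in>U. reach u v" by blast
  let ?V = "\<H> \<inter> \<sigma> (opp t) -` V"
  have ot: "opp t \<in> letters" using step by simp
  have "open ?V"
    using real_moebius_continuous[OF real_moebius_\<sigma>[OF ot]] open_upper_half_plane V(1)
    by (rule continuous_open_preimage)
  moreover have "\<sigma> t w \<in> ?V"
    using V step.hyps(2) \<sigma>_in_H \<sigma>_opp by auto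
  moreover have "\<exists>u\<in>U. reach u v" if "v \<in> ?V" for v
  proof -
    obtain u where u: "u \<in> U" "reach u (\<sigma> (opp t) v)" using V(4) \<open>v \<in> ?V\<close> by blast
    have "reach u (\<sigma> t (\<sigma> (opp t) v))" by (rule reach.step[OF u(2) step.hyps(2)])
    moreover have "\<sigma> t (\<sigma> (opp t) v) = v"
      using \<sigma>_opp[OF ot, of v] that step.hyps(2) by simp
    ultimately show ?thesis using u(1) by auto
  qed
  ultimately show ?case by blast
qed

lemma \<pi>_open:
  assumes "open U" "U \<subseteq> \<H>"
  shows "openin X (\<pi> ` U)"
proof -
  have "open {z \<in> \<H>. \<pi> z \<in> \<pi> ` U}"
    unfolding open_subopen[of "{z \<in> \<H>. \<pi> z \<in> \<pi> ` U}"]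
  proof
    fix w assume "w \<in> {z \<in> \<H>. \<pi> z \<in> \<pi> ` U}"
    then obtain z where z: "w \<in> \<H>" "z \<in> U" "\<pi> z = \<pi> w" by force
    then have "reach z w" using \<pi>_eq_iff assms(2) by blast
    then obtain V where V: "open V" "w \<in> V" "V \<subseteq> \<H>" "\<forall>v\<in>V. \<exists>u\<in>U. reach u v"
      using saturation_nbhd[OF _ z(2) assms] by blast
    have "V \<subseteq> {z \<in> \<H>. \<pi> z \<in> \<pi> ` U}"
    proof
      fix v assume v: "v \<in> V"
      then obtain u where u: "u \<in> U" "reach u v" using V(4) by blast
      then have "\<pi> u = \<pi> v" using \<pi>_eq_iff assms(2) V(3) v by blast
      then show "v \<in> {z \<in> \<H>. \<pi> z \<in> \<pi> ` U}" using u(1) v V(3) by (metis (mono_tags, lifting) image_eqI mem_Collect_eq subsetD)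
    qed
    with V show "\<exists>T. open T \<and> w \<in> T \<and> T \<subseteq> {z \<in> \<H>. \<pi> z \<in> \<pi> ` U}" by blast
  qed
  then show ?thesis
    using assms(2) by (auto simp: openin_quotient_surface openin_open_eq[OF open_upper_half_plane])
qed

text \<open>
  On an open set where it is injective, the open map \<open>\<pi>\<close> is a homeomorphism onto its image.
\<close>
lemma \<pi>_contractible:
  assumes "open U" "U \<subseteq> \<H>" "inj_on \<pi> U" "contractible U"
  shows "contractible_space (subtopology X (\<pi> ` U))"
proof -
  have "homeomorphic_map (top_of_set U) (subtopology X (\<pi> ` U)) \<pi>"
  proof (rule bijective_open_imp_homeomorphic_map)
    show "continuous_map (top_of_set U) (subtopology X (\<pi> ` U)) \<pi>"
      using continuous_map_from_subtopology_mono[OF \<pi>_continuous assms(2)]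
      by (auto simp: continuous_map_in_subtopology)
    show "open_map (top_of_set U) (subtopology X (\<pi> ` U)) \<pi>"
      unfolding open_map_def
    proof (intro allI impI)
      fix V assume "openin (top_of_set U) V"
      then have V: "open V" "V \<subseteq> U" using openin_open_eq[OF assms(1)] by auto
      have "openin X (\<pi> ` V)" using V assms(2) by (intro \<pi>_open) auto
      then show "openin (subtopology X (\<pi> ` U)) (\<pi> ` V)"
        using image_mono[OF V(2), of \<pi>] unfolding openin_subtopology by (metis inf_absorb1)
    qed
    show "\<pi> ` topspace (top_of_set U) = topspace (subtopology X (\<pi> ` U))"
      using assms(2) topspace_X by auto
    show "inj_on \<pi> (topspace (top_of_set U))" using assms(3) by simp
  qed
  then have "top_of_set U homeomorphic_space subtopology X (\<pi> ` U)"
    by (rule homeomorphic_map_imp_homeomorphic_space)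
  then show ?thesis
    using homeomorphic_space_contractibility assms(4) by (metis contractible_space_top_of_set)
qed

text \<open>
  Under these assumptions \<open>\<pi>\<close> embeds the disjoint union of the \<open>A i\<close>
  as an open subset. Seams and collars both enter the homology computation in this way.
\<close>
lemma decomposition_of_images:
  assumes I: "finite I" and A: "\<And>i. i \<in> I \<Longrightarrow> open (A i) \<and> A i \<subseteq> \<H> \<and> A i \<noteq> {} \<and> contractible (A i)"
    and inj: "\<And>i j z w. i \<in> I \<Longrightarrow> j \<in> I \<Longrightarrow> z \<in> A i \<Longrightarrow> w \<in> A j \<Longrightarrow> reach z w \<Longrightarrow> i = j \<and> z = w"
  shows "contractible_decomposition (subtopology X (\<pi> ` (\<Union>i\<in>I. A i))) ((\<lambda>i. \<pi> ` A i) ` I)"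
    and "card ((\<lambda>i. \<pi> ` A i) ` I) = card I"
proof -
  have eq: "i = j \<and> z = w" if "i \<in> I" "j \<in> I" "z \<in> A i" "w \<in> A j" "\<pi> z = \<pi> w" for i j z w
    using inj[OF that(1-4)] \<pi>_eq_iff[of z w] A[OF that(1)] A[OF that(2)] that(3-5) by blast
  have "inj_on (\<lambda>i. \<pi> ` A i) I"
  proof (rule inj_onI)
    fix i j assume ij: "i \<in> I" "j \<in> I" "\<pi> ` A i = \<pi> ` A j"
    obtain z where z: "z \<in> A i" using A[OF ij(1)] by blast
    then obtain w where "w \<in> A j" "\<pi> z = \<pi> w" using ij(3) by blast
    then show "i = j" using eq[OF ij(1,2) z] by blast
  qed
  then show "card ((\<lambda>i. \<pi> ` A i) ` I) = card I" by (rule card_image)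
  let ?Y = "subtopology X (\<pi> ` (\<Union>i\<in>I. A i))"
  have top: "topspace ?Y = (\<Union>i\<in>I. \<pi> ` A i)"
    using A by (auto simp: topspace_X)
  have "openin ?Y (\<pi> ` A i) \<and> \<pi> ` A i \<noteq> {} \<and> contractible_space (subtopology ?Y (\<pi> ` A i))"
    if i: "i \<in> I" for i
  proof (intro conjI)
    have sub: "\<pi> ` A i \<subseteq> \<pi> ` (\<Union>i\<in>I. A i)" using i by blast
    have "openin X (\<pi> ` A i)" using A[OF i] by (intro \<pi>_open) auto
    then show "openin ?Y (\<pi> ` A i)"
      using sub unfolding openin_subtopology by (metis inf_absorb1)
    show "\<pi> ` A i \<noteq> {}" using A[OF i] by simp
    have "inj_on \<pi> (A i)" using eq[OF i i] by (intro inj_onI) blast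
    then have "contractible_space (subtopology X (\<pi> ` A i))"
      using A[OF i] by (intro \<pi>_contractible) auto
    moreover have "subtopology ?Y (\<pi> ` A i) = subtopology X (\<pi> ` A i)"
      using sub by (simp add: subtopology_subtopology inf_absorb2)
    ultimately show "contractible_space (subtopology ?Y (\<pi> ` A i))" by simp
  qed
  moreover have "disjoint ((\<lambda>i. \<pi> ` A i) ` I)"
  proof (rule pairwise_imageI)
    fix i j assume ij: "i \<in> I" "j \<in> I" "i \<noteq> j"
    show "disjnt (\<pi> ` A i) (\<pi> ` A j)"
      unfolding disjnt_iff
    proof (intro allI notI)
      fix y assume "y \<in> \<pi> ` A i \<and> y \<in> \<pi> ` A j"
      then obtain z w where "z \<in> A i" "w \<in> A j" "\<pi> z = \<pi> w" by force
      then show False using eq[OF ij(1,2)] ij(3) by blast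
    qed
  qed
  ultimately show "contractible_decomposition ?Y ((\<lambda>i. \<pi> ` A i) ` I)"
    unfolding contractible_decomposition_def using I top by auto
qed

end

section \<open>Seams, collars and the Euler characteristic\<close>

text \<open>
  Since the half-discs are not tangent, all of them can be enlarged by the same amount
  \<open>e\<close> and remain disjoint.
\<close>
locale collared_schottky = schottky +
  fixes e :: real
  assumes e_pos: "e > 0"
    and wide_gap: "s \<in> letters \<Longrightarrow> t \<in> letters \<Longrightarrow> s \<noteq> t \<Longrightarrow> r s + r t + 2 * e < \<bar>c s - c t\<bar>"
begin

abbreviation "D_plus t \<equiv> half_disc (c t) (r t + e)"

text \<open>
  The collar of disc \<open>t\<close> is a half-annulus inside the polygon. The seam is a strip around the
  boundary arc of disc \<open>t\<close>: it consists of the collar, the arc, and the part of the disc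
  that \<open>\<sigma> t\<close> maps onto the collar of disc \<open>opp t\<close>. In the quotient it is
  a neighbourhood of the arc along which the sides \<open>t\<close> and \<open>opp t\<close> are glued.
\<close>
definition collar :: "nat \<Rightarrow> complex set" where "collar t = D_plus t \<inter> E t"

definition seam :: "nat \<Rightarrow> complex set" where
  "seam j = {z \<in> D_plus j. \<sigma> j z \<in> D_plus (opp j)}"

lemma D_B_subset_D_plus: "z \<in> D t \<or> z \<in> B t \<Longrightarrow> z \<in> D_plus t"
  using e_pos by (auto simp: in_half_disc in_half_disc_boundary)

lemma D_plus_in_H: "z \<in> D_plus t \<Longrightarrow> z \<in> \<H>"
  by (simp add: in_half_disc in_H)

lemma seam_subset_H: "seam t \<subseteq> \<H>"
  unfolding seam_def using D_plus_in_H by blast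

lemma D_plus_outside_others:
  assumes "s \<in> letters" "t \<in> letters" "s \<noteq> t" "z \<in> D_plus t"
  shows "z \<in> E s" "z \<notin> D_plus s"
proof -
  have "cmod (z - of_real (c s)) > r s + e"
    using near_disc_far_from_others[where z = z and t = t and \<rho> = "r t + e" and s = s and \<rho>' = "r s + e"]
      wide_gap[OF assms(1-3)] assms(4) by (simp add: in_half_disc)
  then show "z \<in> E s" "z \<notin> D_plus s"
    using assms(4) e_pos by (auto simp: in_half_disc in_half_disc_exterior)
qed

lemma collar_subset_F_int: "t \<in> letters \<Longrightarrow> z \<in> collar t \<Longrightarrow> z \<in> F_int"
  unfolding collar_def F_int_def using D_plus_outside_others(1) D_plus_in_H by blast

lemma collar_disjoint: "s \<in> letters \<Longrightarrow> t \<in> letters \<Longrightarrow> z \<in> collar s \<Longrightarrow> z \<in> collar t \<Longrightarrow> s = t"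
  unfolding collar_def using D_plus_outside_others(2) by blast

lemma B_disjoint: "s \<in> letters \<Longrightarrow> t \<in> letters \<Longrightarrow> z \<in> B s \<Longrightarrow> z \<in> B t \<Longrightarrow> s = t"
  using closed_disc_in_other_exterior DBE_disjoint by blast

lemma collar_subset_seam:
  assumes "t \<in> letters" "z \<in> collar t"
  shows "z \<in> seam t"
  using assms \<sigma>_maps(1) D_B_subset_D_plus by (auto simp: collar_def seam_def)

lemma B_subset_seam:
  assumes "t \<in> letters" "z \<in> B t"
  shows "z \<in> seam t"
  using assms \<sigma>_maps(2) D_B_subset_D_plus by (auto simp: seam_def)

lemma seam_opp:
  assumes t: "t \<in> letters" and z: "z \<in> seam t"
  shows "\<sigma> t z \<in> seam (opp t)"
proof -
  have "\<sigma> (opp t) (\<sigma> t z) = z" using \<sigma>_opp[OF t] z seam_subset_H by blast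
  then show ?thesis using z t by (simp add: seam_def)
qed

lemma seam_cases:
  assumes t: "t \<in> letters" and z: "z \<in> seam t"
  obtains "z \<in> collar t" | "z \<in> B t" | "\<sigma> t z \<in> collar (opp t)"
proof -
  have zH: "z \<in> \<H>" using z seam_subset_H by blast
  show thesis
  proof (rule H_cases[OF zH, of t])
    assume "z \<in> D t"
    then show thesis using that(3) \<sigma>_maps(3)[OF t] z by (simp add: collar_def seam_def)
  next
    assume "z \<in> E t"
    then show thesis using that(1) z by (simp add: collar_def seam_def)
  qed (rule that(2))
qed

text \<open>
  Side pairings only move boundary points, and boundary points are not interior.
\<close>
lemma F_int_reach_eq:
  assumes "reach z w" "z \<in> F_int" "w \<in> F"
  shows "w = z"
  using ping_pong[OF assms(1)] assms F_int_subset_F B_not_F_int by blast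

lemma letters_generators:
  assumes "i \<in> {1..n}" "j \<in> {1..n}"
  shows "opp j \<noteq> i"
  using assms by (auto simp: opp_def)

text \<open>
  Every point of a seam is equivalent to a point of the polygon by at most one letter: to itself on the
  collar and on the arc, to its image under \<open>\<sigma> i\<close> beyond the arc. Comparing
  these representatives by \<open>ping_pong\<close> leaves only the collars and arcs of the seam itself,
  because the indices are restricted to one side from each pair.
\<close>
lemma seam_reach_eq:
  assumes ij: "i \<in> {1..n}" "j \<in> {1..n}" and z: "z \<in> seam i" and w: "w \<in> seam j" and zw: "reach z w"
  shows "i = j \<and> z = w"
proof -
  have L: "i \<in> letters" "j \<in> letters" "opp i \<in> letters" "opp j \<in> letters"
    using generator_letter ij opp_letters by blast+
  have zH: "z \<in> \<H>" and wH: "w \<in> \<H>" using z w seam_subset_H by blast+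
  have wz: "reach w z" using reach_sym[OF zw zH] .
  have reach_pull: "reach (\<sigma> s x) y" if "reach x y" "s \<in> letters" "x \<in> \<H>" for s x y
    using reach_trans[OF that(1)] reach_sym[OF reach_single[OF that(2)] that(3)] by blast
  have BF: "x \<in> F" if "x \<in> B t" "t \<in> letters" for x t using B_subset_F that by blast
  have AF: "x \<in> F_int" "x \<in> F" if "x \<in> collar t" "t \<in> letters" for x t
    using collar_subset_F_int that F_int_subset_F by blast+
  show ?thesis
  proof (rule seam_cases[OF L(1) z])
    assume zA: "z \<in> collar i"
    show ?thesis
    proof (rule seam_cases[OF L(2) w])
      assume "w \<in> collar j"
      then have "w = z" using F_int_reach_eq[OF zw] AF zA L by blast
      then show ?thesis using collar_disjoint L zA \<open>w \<in> collar j\<close> by blast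
    next
      assume "w \<in> B j"
      then have "w = z" using F_int_reach_eq[OF zw] AF BF zA L by blast
      then show ?thesis using \<open>w \<in> B j\<close> AF zA L B_not_F_int by blast
    next
      assume wA: "\<sigma> j w \<in> collar (opp j)"
      have "reach z (\<sigma> j w)" using zw L(2) by (rule reach.step)
      then have "\<sigma> j w = z" using F_int_reach_eq AF zA wA L by blast
      then have "opp j = i" using collar_disjoint L zA wA by metis
      then show ?thesis using letters_generators[OF ij] by blast
    qed
  next
    assume zB: "z \<in> B i"
    show ?thesis
    proof (rule seam_cases[OF L(2) w])
      assume "w \<in> collar j"
      then have "z = w" using F_int_reach_eq[OF wz] AF BF zB L by blast
      then show ?thesis using \<open>w \<in> collar j\<close> AF zB L B_not_F_int by blast
    next
      assume wB: "w \<in> B j"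
      from ping_pong[OF zw BF[OF zB L(1)] BF[OF wB L(2)]] show ?thesis
      proof (elim disjE bexE conjE)
        assume "w = z"
        then show ?thesis using B_disjoint L zB wB by blast
      next
        fix t assume t: "t \<in> letters" "z \<in> B t" "w \<in> B (opp t)"
        then have "t = i" "opp t = j" using B_disjoint zB wB L opp_letters by blast+
        then show ?thesis using letters_generators[OF ij(2,1)] by blast
      qed
    next
      assume wA: "\<sigma> j w \<in> collar (opp j)"
      have "reach (\<sigma> j w) z" using reach_pull[OF wz L(2) wH] .
      then have "z = \<sigma> j w" using F_int_reach_eq AF BF zB wA L by blast
      then show ?thesis using wA AF zB L B_not_F_int by metis
    qed
  next
    assume zA: "\<sigma> i z \<in> collar (opp i)"
    have zw': "reach (\<sigma> i z) w" using reach_pull[OF zw L(1) zH] .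
    show ?thesis
    proof (rule seam_cases[OF L(2) w])
      assume "w \<in> collar j"
      then have "w = \<sigma> i z" using F_int_reach_eq[OF zw'] AF zA L by blast
      then have "opp i = j" using collar_disjoint L zA \<open>w \<in> collar j\<close> by metis
      then show ?thesis using letters_generators[OF ij(2,1)] by blast
    next
      assume "w \<in> B j"
      then have "w = \<sigma> i z" using F_int_reach_eq[OF zw'] AF BF zA L by blast
      then show ?thesis using \<open>w \<in> B j\<close> AF zA L B_not_F_int by metis
    next
      assume wA: "\<sigma> j w \<in> collar (opp j)"
      have "reach (\<sigma> i z) (\<sigma> j w)" using zw' L(2) by (rule reach.step)
      then have eq: "\<sigma> j w = \<sigma> i z" using F_int_reach_eq AF zA wA L by blast
      then have "opp i = opp j" using collar_disjoint L zA wA by metis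
      then have "i = j" using opp_opp L by metis
      moreover have "z = w"
        using eq \<sigma>_opp[OF L(1) zH] \<sigma>_opp[OF L(2) wH] \<open>i = j\<close> by metis
      ultimately show ?thesis by blast
    qed
  qed
qed

lemma collar_reach_eq:
  assumes "s \<in> letters" "t \<in> letters" "z \<in> collar s" "w \<in> collar t" "reach z w"
  shows "s = t \<and> z = w"
proof -
  have "w = z"
    using F_int_reach_eq[OF assms(5)] collar_subset_F_int assms(1-4) F_int_subset_F by blast
  then show ?thesis using collar_disjoint assms(1-4) by blast
qed

lemma contractible_if_linear_region:
  fixes I :: "'i set"
  assumes "Y = {z \<in> \<H>. \<forall>i\<in>I. \<alpha> i * (cmod z)\<^sup>2 + \<beta> i * Re z + \<gamma> i < (0::real)}"
  shows "contractible Y"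
  unfolding assms by (rule contractible_linear_region)

lemma contractible_F_int: "contractible F_int"
proof (rule contractible_if_linear_region)
  show "F_int = {z \<in> \<H>. \<forall>t\<in>letters. - 1 * (cmod z)\<^sup>2 + 2 * c t * Re z + ((r t)\<^sup>2 - (c t)\<^sup>2) < 0}"
    unfolding F_int_def using half_disc_exterior_linear r_pos by blast
qed

lemma contractible_collar:
  assumes "t \<in> letters"
  shows "contractible (collar t)"
proof (rule contractible_if_linear_region)
  show "collar t = {z \<in> \<H>. \<forall>b\<in>UNIV. (if b then 1 else - 1) * (cmod z)\<^sup>2
      + (if b then - 2 * c t else 2 * c t) * Re z
      + (if b then (c t)\<^sup>2 - (r t + e)\<^sup>2 else (r t)\<^sup>2 - (c t)\<^sup>2) < 0}"
    using half_disc_exterior_linear[OF r_pos[OF assms], of _ "c t"]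
      half_disc_linear[of "r t + e" _ "c t"] r_pos[OF assms] e_pos D_plus_in_H[of _ t]
    unfolding collar_def by (auto simp: UNIV_bool)
qed

lemma contractible_seam:
  assumes t: "t \<in> letters"
  shows "contractible (seam t)"
proof -
  have "r (opp t) + e > 0" using r_pos[of "opp t"] t e_pos by simp
  then obtain \<alpha> \<beta> \<gamma> :: real where m: "\<And>z. z \<in> \<H> \<Longrightarrow>
    \<sigma> t z \<in> D_plus (opp t) \<longleftrightarrow> \<alpha> * (cmod z)\<^sup>2 + \<beta> * Re z + \<gamma> < 0"
    using real_moebius_half_disc_linear[OF real_moebius_\<sigma>[OF t], of "r (opp t) + e" "c (opp t)"] by blast
  show ?thesis
  proof (rule contractible_if_linear_region)
    show "seam t = {z \<in> \<H>. \<forall>b\<in>UNIV. (if b then 1 else \<alpha>) * (cmod z)\<^sup>2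
        + (if b then - 2 * c t else \<beta>) * Re z
        + (if b then (c t)\<^sup>2 - (r t + e)\<^sup>2 else \<gamma>) < 0}"
      using m half_disc_linear[of "r t + e" _ "c t"] r_pos[OF t] e_pos D_plus_in_H[of _ t]
      unfolding seam_def by (auto simp: UNIV_bool)
  qed
qed

lemma open_half_disc: "open (half_disc a \<rho>)"
  unfolding half_disc_def using open_upper_half_plane by auto

lemma open_half_disc_exterior: "open (half_disc_exterior a \<rho>)"
  unfolding half_disc_exterior_def using open_upper_half_plane by auto

lemma open_collar: "open (collar t)"
  unfolding collar_def using open_half_disc open_half_disc_exterior by blast

lemma open_seam:
  assumes "t \<in> letters"
  shows "open (seam t)"
proof -
  have "seam t = D_plus t \<inter> (\<H> \<inter> \<sigma> t -` D_plus (opp t))"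
    using D_plus_in_H by (auto simp: seam_def)
  moreover have "open (\<H> \<inter> \<sigma> t -` D_plus (opp t))"
    using real_moebius_continuous[OF real_moebius_\<sigma>[OF assms]] open_upper_half_plane open_half_disc
    by (rule continuous_open_preimage)
  ultimately show ?thesis using open_half_disc by auto
qed

lemma open_F_int: "open F_int"
proof -
  have "F_int = \<H> \<inter> (\<Inter>t\<in>letters. E t)" by (auto simp: F_int_def)
  then show ?thesis
    using open_upper_half_plane open_half_disc_exterior
    by (simp add: open_Int open_INT)
qed

lemma B_nonempty: "t \<in> letters \<Longrightarrow> B t \<noteq> {}"
proof -
  assume "t \<in> letters"
  then have "Complex (c t) (r t) \<in> B t"
    using r_pos[of t] by (simp add: in_half_disc_boundary cmod_def)
  then show ?thesis by blast
qed

lemma collar_nonempty: "t \<in> letters \<Longrightarrow> collar t \<noteq> {}"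
proof -
  assume "t \<in> letters"
  then have "Complex (c t) (r t + e / 2) \<in> collar t"
    using r_pos[of t] e_pos by (simp add: collar_def in_half_disc in_half_disc_exterior cmod_def)
  then show ?thesis by blast
qed

text \<open>
  Removing its arc splits a seam into two collars, one on each of the paired sides. So the overlap of
  polygon and seams has twice as many components as there are seams.
\<close>
lemma core_meets_seams: "\<pi> ` F_int \<inter> \<pi> ` (\<Union>j\<in>{1..n}. seam j) = \<pi> ` (\<Union>t\<in>letters. collar t)"
proof (intro equalityI subsetI)
  fix y assume "y \<in> \<pi> ` F_int \<inter> \<pi> ` (\<Union>j\<in>{1..n}. seam j)"
  then obtain z w j where zw: "y = \<pi> z" "z \<in> F_int" "y = \<pi> w" "j \<in> {1..n}" "w \<in> seam j"
    by blast
  have j: "j \<in> letters" using generator_letter[OF zw(4)] by blast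
  have H: "z \<in> \<H>" "w \<in> \<H>" using zw seam_subset_H by (auto simp: F_int_def)
  have reach: "reach z w" using \<pi>_eq_iff[OF H] zw by simp
  show "y \<in> \<pi> ` (\<Union>t\<in>letters. collar t)"
  proof (rule seam_cases[OF j zw(5)])
    assume "w \<in> collar j"
    then show ?thesis using zw(3) j by blast
  next
    assume "w \<in> B j"
    then have "w = z" using F_int_reach_eq[OF reach zw(2)] B_subset_F[OF j] by blast
    then show ?thesis using \<open>w \<in> B j\<close> zw(2) B_not_F_int[OF j] by blast
  next
    assume "\<sigma> j w \<in> collar (opp j)"
    moreover have "\<pi> (\<sigma> j w) = y"
      using \<pi>_eq_iff[OF H(2) \<sigma>_in_H[OF j H(2)]] reach_single[OF j] zw(3) by simp
    ultimately show ?thesis using j opp_letters by blast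
  qed
next
  fix y assume "y \<in> \<pi> ` (\<Union>t\<in>letters. collar t)"
  then obtain t z where tz: "t \<in> letters" "z \<in> collar t" "y = \<pi> z" by blast
  have "y \<in> \<pi> ` F_int" using tz collar_subset_F_int by blast
  moreover have "y \<in> \<pi> ` (\<Union>j\<in>{1..n}. seam j)"
  proof (rule letter_cases[OF tz(1)])
    assume "t \<in> {1..n}"
    then show ?thesis using collar_subset_seam tz by blast
  next
    fix j assume j: "j \<in> {1..n}" "t = opp j"
    have zN: "z \<in> seam t" using collar_subset_seam tz by blast
    then have zH: "z \<in> \<H>" using seam_subset_H by blast
    have "opp t = j" using j generator_letter[OF j(1)] by (metis opp_opp)
    then have "\<sigma> t z \<in> seam j" using seam_opp[OF tz(1) zN] by simp
    moreover have "\<pi> (\<sigma> t z) = y"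
      using \<pi>_eq_iff[OF zH \<sigma>_in_H[OF tz(1) zH]] reach_single[OF tz(1)] tz(3) by simp
    ultimately show ?thesis using j(1) by blast
  qed
  ultimately show "y \<in> \<pi> ` F_int \<inter> \<pi> ` (\<Union>j\<in>{1..n}. seam j)" by blast
qed

text \<open>
  A point of the polygon that is not interior lies on one of the arcs, and on those with letter above
  \<open>n\<close> the pairing moves it to the arc that carries a seam.
\<close>
lemma core_seams_cover: "\<pi> ` F_int \<union> \<pi> ` (\<Union>j\<in>{1..n}. seam j) = topspace X"
proof
  show "\<pi> ` F_int \<union> \<pi> ` (\<Union>j\<in>{1..n}. seam j) \<subseteq> topspace X"
    using seam_subset_H by (auto simp: topspace_X F_int_def)
  show "topspace X \<subseteq> \<pi> ` F_int \<union> \<pi> ` (\<Union>j\<in>{1..n}. seam j)"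
  proof
    fix y assume "y \<in> topspace X"
    then obtain x where x: "x \<in> \<H>" "y = \<pi> x" by (auto simp: topspace_X)
    then obtain z where z: "z \<in> F" "reach x z" using translates_cover by blast
    have zH: "z \<in> \<H>" using z by (simp add: F_def)
    have yz: "y = \<pi> z" using \<pi>_eq_iff[OF x(1) zH] z(2) x(2) by simp
    show "y \<in> \<pi> ` F_int \<union> \<pi> ` (\<Union>j\<in>{1..n}. seam j)"
    proof (rule F_cases[OF z(1)])
      assume "z \<in> F_int"
      then show ?thesis using yz by blast
    next
      fix t assume t: "t \<in> letters" "z \<in> B t"
      show ?thesis
      proof (rule letter_cases[OF t(1)])
        assume "t \<in> {1..n}"
        then show ?thesis using B_subset_seam t yz by blast
      next
        fix j assume j: "j \<in> {1..n}" "t = opp j"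
        have "opp t = j" using j generator_letter[OF j(1)] by (metis opp_opp)
        then have "\<sigma> t z \<in> seam j" using seam_opp[OF t(1) B_subset_seam[OF t]] by simp
        moreover have "\<pi> (\<sigma> t z) = y"
          using \<pi>_eq_iff[OF zH \<sigma>_in_H[OF t(1) zH]] reach_single[OF t(1)] yz by simp
        ultimately show ?thesis using j(1) by blast
      qed
    qed
  qed
qed

text \<open>
  One contractible piece for the polygon, \<open>n\<close> for the seams, and
  \<open>2 * n\<close> for their overlap.
\<close>
lemma euler_characteristic_collared: "euler_characteristic X = 1 - int n"
proof -
  let ?U = "\<pi> ` F_int" and ?V = "\<pi> ` (\<Union>j\<in>{1..n}. seam j)" and ?W = "\<pi> ` (\<Union>t\<in>letters. collar t)"
  let ?\<V> = "(\<lambda>j. \<pi> ` seam j) ` {1..n}" and ?\<W> = "(\<lambda>t. \<pi> ` collar t) ` letters"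
  have gl: "j \<in> letters" if "j \<in> {1..n}" for j using generator_letter that by blast
  have N: "open (seam j) \<and> seam j \<subseteq> \<H> \<and> seam j \<noteq> {} \<and> contractible (seam j)" if "j \<in> {1..n}" for j
    using open_seam[OF gl[OF that]] seam_subset_H contractible_seam[OF gl[OF that]]
      B_subset_seam[OF gl[OF that]] B_nonempty[OF gl[OF that]] by blast
  have A: "open (collar t) \<and> collar t \<subseteq> \<H> \<and> collar t \<noteq> {} \<and> contractible (collar t)" if "t \<in> letters" for t
    using open_collar contractible_collar[OF that] collar_nonempty[OF that] D_plus_in_H unfolding collar_def by blast
  have V: "contractible_decomposition (subtopology X ?V) ?\<V>" "card ?\<V> = n"
    using decomposition_of_images[where I = "{1..n}" and A = seam, OF finite_atLeastAtMost N seam_reach_eq]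
    by simp_all
  have W: "contractible_decomposition (subtopology X ?W) ?\<W>" "card ?\<W> = 2 * n"
    using decomposition_of_images[where I = letters and A = collar, OF finite_letters A collar_reach_eq]
    by (simp_all add: letters_def)
  have one: "1 \<in> letters" "1 \<in> {1..n}" using n_pos by (auto simp: letters_def)
  have F_int_H: "F_int \<subseteq> \<H>" by (auto simp: F_int_def)
  have inj: "inj_on \<pi> F_int"
  proof (rule inj_onI)
    fix z w assume zw: "z \<in> F_int" "w \<in> F_int" "\<pi> z = \<pi> w"
    then have "reach z w" using \<pi>_eq_iff F_int_H by blast
    then show "z = w" using F_int_reach_eq zw F_int_subset_F by blast
  qed
  have "euler_characteristic X = 1 + int (card ?\<V>) - int (card ?\<W>)"
  proof (rule euler_characteristic_of_cover)
    have "path_connectedin X (\<pi> ` \<H>)"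
      using path_connectedin_continuous_map_image[OF \<pi>_continuous, of \<H>]
        convex_imp_path_connected[OF convex_upper_half_plane]
      by (simp add: path_connectedin_subtopology path_connectedin_euclidean)
    then show "path_connected_space X"
      by (simp add: topspace_X flip: path_connectedin_topspace)
    show "topspace X \<noteq> {}" using F_nonempty by (auto simp: topspace_X F_def)
    show "openin X ?U" using open_F_int F_int_H by (rule \<pi>_open)
    show "contractible_space (subtopology X ?U)"
      using open_F_int F_int_H inj contractible_F_int by (rule \<pi>_contractible)
    show "openin X ?V" using N by (intro \<pi>_open open_UN UN_least ballI) blast+
    show "contractible_decomposition (subtopology X ?V) ?\<V>" by (rule V)
    show "?V \<noteq> {}" using N[OF one(2)] one(2) by blast
    show "contractible_decomposition (subtopology X (?U \<inter> ?V)) ?\<W>"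
      unfolding core_meets_seams by (rule W)
    show "?U \<inter> ?V \<noteq> {}" unfolding core_meets_seams using A[OF one(1)] one(1) by blast
    show "?U \<union> ?V = topspace X" by (rule core_seams_cover)
    show "card ?\<V> \<le> card ?\<W>" using V(2) W(2) by simp
  qed
  then show ?thesis using V(2) W(2) by simp
qed

end

theorem (in schottky) euler_characteristic_quotient: "euler_characteristic X = 1 - int n"
proof -
  let ?P = "{p \<in> letters \<times> letters. fst p \<noteq> snd p}"
  let ?\<delta> = "\<lambda>p. (\<bar>c (fst p) - c (snd p)\<bar> - r (fst p) - r (snd p)) / 2"
  have "?\<delta> p > 0" if "p \<in> ?P" for p
    using that gap[of "fst p" "snd p"] by auto
  then obtain e where e: "e > 0" "\<And>p. p \<in> ?P \<Longrightarrow> e < ?\<delta> p"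
    using finite_positive_lower_bound[of ?P ?\<delta>] by auto
  interpret collared_schottky n c r S e
  proof
    fix s t assume "s \<in> letters" "t \<in> letters" "s \<noteq> t"
    then show "r s + r t + 2 * e < \<bar>c s - c t\<bar>" using e(2)[of "(s, t)"] by simp
  qed (rule e(1))
  show ?thesis by (rule euler_characteristic_collared)
qed

lemma euler_characteristic_fuchsian_schottky:
  assumes "n \<ge> 1" "fuchsian_schottky_group n G"
  shows "euler_characteristic (quotient_surface G) = 1 - int n"
proof -
  obtain c r S where d: "schottky_data n c r S" "G = generate (BijGroup upper_half_plane) (S ` {1..n})"
    using assms(2) unfolding fuchsian_schottky_group_def by blast
  interpret schottky n c r S using d(1) assms(1) by unfold_locales
  show ?thesis using euler_characteristic_quotient unfolding \<Gamma>_def d(2) .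
qed

section \<open>Types of surfaces\<close>

lemma surface_types_of_euler_characteristic:
  assumes "euler_characteristic X = 1 - int n"
  shows "surface_types X = (\<lambda>g. (g, n + 1 - 2 * g)) ` {..n div 2}"
proof (intro equalityI subsetI)
  fix p assume "p \<in> surface_types X"
  then obtain g f where p: "p = (g, f)" "f \<ge> 1" "1 - int n = 2 - 2 * int g - int f"
    using assms unfolding surface_types_def by auto
  have "f = n + 1 - 2 * g" "g \<le> n div 2" using p(2,3) by linarith+
  then show "p \<in> (\<lambda>g. (g, n + 1 - 2 * g)) ` {..n div 2}" using p(1) by blast
next
  fix p assume "p \<in> (\<lambda>g. (g, n + 1 - 2 * g)) ` {..n div 2}"
  then obtain g where g: "p = (g, n + 1 - 2 * g)" "2 * g \<le> n" by auto
  have "int (n + 1 - 2 * g) = int n + 1 - 2 * int g" using g(2) by simp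
  then show "p \<in> surface_types X" using assms g unfolding surface_types_def by auto
qed

theorem theorem5p1:
  fixes n :: nat and \<Gamma> :: "(complex \<Rightarrow> complex) set"
  assumes "n \<ge> 1"
    and "fuchsian_schottky_group n \<Gamma>"
  shows "let T = surface_types (quotient_surface \<Gamma>) in
    finite T \<and>
    (even n \<longrightarrow> real (card T) = (real n + 2) / 2) \<and>
    (odd n \<longrightarrow> real (card T) = (real n + 1) / 2) \<and>
    (Max (snd ` T) = n + 1 \<and> (0, n + 1) \<in> T \<and> (\<forall>(g, f) \<in> T. g = 0 \<longrightarrow> f = n + 1)) \<and>
    (even n \<longrightarrow> Min (snd ` T) = 1 \<and> (n div 2, 1) \<in> T \<and>
       (\<forall>(g, f) \<in> T. g = n div 2 \<longrightarrow> f = 1)) \<and>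
    (odd n \<longrightarrow> Min (snd ` T) = 2 \<and> ((n - 1) div 2, 2) \<in> T \<and>
       (\<forall>(g, f) \<in> T. g = (n - 1) div 2 \<longrightarrow> f = 2))"
proof -
  define T where "T = (\<lambda>g. (g, n + 1 - 2 * g)) ` {..n div 2}"
  have surface_types: "surface_types (quotient_surface \<Gamma>) = T"
    unfolding T_def using assms
    by (intro surface_types_of_euler_characteristic euler_characteristic_fuchsian_schottky)
  have mem: "(g, f) \<in> T \<longleftrightarrow> g \<le> n div 2 \<and> f = n + 1 - 2 * g" for g f
    by (auto simp: T_def)
  have snd_T: "snd ` T = (\<lambda>g. n + 1 - 2 * g) ` {..n div 2}"
    by (simp add: T_def image_image)
  have fin: "finite T" by (simp add: T_def)
  have card: "card T = n div 2 + 1"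
    unfolding T_def by (subst card_image) (auto simp: inj_on_def)
  have Max: "Max (snd ` T) = n + 1"
    unfolding snd_T by (rule Max_eqI) (auto intro: image_eqI[of _ _ 0])
  have Min: "Min (snd ` T) = n + 1 - 2 * (n div 2)"
    unfolding snd_T by (rule Min_eqI) auto
  show ?thesis
    unfolding Let_def surface_types
  proof (intro conjI impI)
    show "even n \<Longrightarrow> real (card T) = (real n + 2) / 2"
      unfolding card by (auto elim!: evenE)
    show "odd n \<Longrightarrow> real (card T) = (real n + 1) / 2"
      unfolding card by (auto elim!: oddE)
    show "even n \<Longrightarrow> Min (snd ` T) = 1" "odd n \<Longrightarrow> Min (snd ` T) = 2"
      unfolding Min by (auto elim!: evenE oddE)
    show "even n \<Longrightarrow> (n div 2, 1) \<in> T" "odd n \<Longrightarrow> ((n - 1) div 2, 2) \<in> T"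
      by (auto simp: mem elim!: evenE oddE)
    show "even n \<Longrightarrow> \<forall>(g, f)\<in>T. g = n div 2 \<longrightarrow> f = 1"
      "odd n \<Longrightarrow> \<forall>(g, f)\<in>T. g = (n - 1) div 2 \<longrightarrow> f = 2"
      by (auto simp: mem elim!: evenE oddE)
  qed (use fin Max in \<open>auto simp: mem\<close>)
qed

end
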